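(* Let $m,n,r$ be positive integers with $r \le \min(m,n)$. Let $\mathbf{B} = \mathbf{A} + \mathbf{Z}$, where $\mathbf{A},\mathbf{Z} \in \mathbb{R}^{m\times n}$ and $\mathrm{rank}(\mathbf{A}) = r$. Let $\mathbf{U}\in\mathbb{R}^{m\times r},\mathbf{V}\in\mathbb{R}^{n\times r}$ (respectively $\widehat{\mathbf{U}}\in\mathbb{R}^{m\times r},\widehat{\mathbf{V}}\in\mathbb{R}^{n\times r}$) be the matrices with orthonormal columns consisting of the leading $r$ left and right singular vectors of $\mathbf{A}$ (respectively of $\mathbf{B}$). Then for any $q\in[1,\infty]$, $$\max\left\{\|\sin\Theta(\widehat{\mathbf{U}},\mathbf{U})\|_q,\ \|\sin\Theta(\widehat{\mathbf{V}},\mathbf{V})\|_q\right\}\le \frac{2\,\|\mathbf{Z}_{\max(r)}\|_q}{\sigma_r(\mathbf{A})}.$$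
   Context: For a real matrix $\mathbf{M}\in\mathbb{R}^{m\times n}$, $\sigma_1(\mathbf{M})\ge\cdots\ge\sigma_{\min(m,n)}(\mathbf{M})\ge 0$ are its singular values. The Schatten-$q$ norm is $\|\mathbf{M}\|_q = \left(\sum_{i=1}^{\min(m,n)} \sigma_i(\mathbf{M})^q\right)^{1/q}$ for $1\le q<\infty$, and $\|\mathbf{M}\|_\infty = \sigma_1(\mathbf{M})$ is the spectral norm. Given a singular value decomposition $\mathbf{M} = \sum_{i}\sigma_i(\mathbf{M})\mathbf{u}_i\mathbf{v}_i^\top$, with singular values in decreasing order, $\mathbf{M}_{\max(r)} = \sum_{i=1}^r \sigma_i(\mathbf{M})\mathbf{u}_i\mathbf{v}_i^\top$, and the leading $r$ left and right singular vectors are $\mathbf{u}_1,\dots,\mathbf{u}_r$ and $\mathbf{v}_1,\dots,\mathbf{v}_r$. For two $p\times r$ matrices $\mathbf{U}_1,\mathbf{U}_2$ with orthonormal columns, let $\sigma_1\ge\cdots\ge\sigma_r\ge0$ be the singular values of $\mathbf{U}_1^\top\mathbf{U}_2$. Then $\Theta(\mathbf{U}_1,\mathbf{U}_2) = \mathrm{diag}(\cos^{-1}(\sigma_1),\dots,\cos^{-1}(\sigma_r))$ and the Schatten-$q$ $\sin\Theta$ distance is $$\|\sin\Theta(\mathbf{U}_1,\mathbf{U}_2)\|_q = \left\|\mathrm{diag}(\sin\cos^{-1}(\sigma_1),\dots,\sin\cos^{-1}(\sigma_r))\right\|_q = \left(\sum_{i=1}^r(1-\sigma_i^2)^{q/2}\right)^{1/q},$$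 the last expression being read as $\max_i (1-\sigma_i^2)^{1/2}$ when $q=\infty$. *)

theory Defs
  imports
    "Jordan_Normal_Form.Char_Poly"
    "Jordan_Normal_Form.DL_Rank"
    "HOL-Library.Multiset"
    "HOL-Library.Extended_Real"
    Complex_Main
begin

(* Indices of singular values and singular vectors start at 1: the i-th singular value is the
   square root of the i-th largest eigenvalue, counted with multiplicity, of M^T M.
   Only indices up to min (dim_row M) (dim_col M) are meaningful. *)
definition singular_value :: "real mat \<Rightarrow> nat \<Rightarrow> real" where
  "singular_value M i =
     sqrt (rev (sorted_list_of_multiset (proots (char_poly (transpose_mat M * M)))) ! (i - 1))"

definition schatten_norm :: "ereal \<Rightarrow> real mat \<Rightarrow> real" where
  "schatten_norm q M =
     (if q = \<infinity> then singular_value M 1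
      else (\<Sum>i = 1..min (dim_row M) (dim_col M). singular_value M i powr real_of_ereal q)
             powr (1 / real_of_ereal q))"

definition orthonormal_upto :: "nat \<Rightarrow> nat \<Rightarrow> (nat \<Rightarrow> real vec) \<Rightarrow> bool" where
  "orthonormal_upto d k u \<longleftrightarrow>
     (\<forall>i\<in>{1..k}. u i \<in> carrier_vec d) \<and>
     (\<forall>i\<in>{1..k}. \<forall>j\<in>{1..k}. u i \<bullet> u j = (if i = j then 1 else 0))"

(* The sum over i = 1..r of sigma_i(M) u_i v_i^T, written entrywise. *)
definition svd_sum :: "real mat \<Rightarrow> (nat \<Rightarrow> real vec) \<Rightarrow> (nat \<Rightarrow> real vec) \<Rightarrow> nat \<Rightarrow> real mat" where
  "svd_sum M u v r =
     mat (dim_row M) (dim_col M)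
       (\<lambda>(a, b). \<Sum>i = 1..r. singular_value M i * (u i $ a) * (v i $ b))"

definition is_svd :: "real mat \<Rightarrow> (nat \<Rightarrow> real vec) \<Rightarrow> (nat \<Rightarrow> real vec) \<Rightarrow> bool" where
  "is_svd M u v \<longleftrightarrow>
     orthonormal_upto (dim_row M) (min (dim_row M) (dim_col M)) u \<and>
     orthonormal_upto (dim_col M) (min (dim_row M) (dim_col M)) v \<and>
     M = svd_sum M u v (min (dim_row M) (dim_col M))"

(* Neither the truncation M_max(r) nor the leading singular vectors are unique when singular
   values coincide or vanish, so both are relations: some decomposition produces them. *)
definition is_svd_truncation :: "nat \<Rightarrow> real mat \<Rightarrow> real mat \<Rightarrow> bool" where
  "is_svd_truncation r M T \<longleftrightarrow> (\<exists>u v. is_svd M u v \<and> T = svd_sum M u v r)"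

definition leading_singular_vectors :: "nat \<Rightarrow> real mat \<Rightarrow> real mat \<Rightarrow> real mat \<Rightarrow> bool" where
  "leading_singular_vectors r M U V \<longleftrightarrow>
     (\<exists>u v. is_svd M u v \<and>
        U = mat_of_cols (dim_row M) (map u [1..<Suc r]) \<and>
        V = mat_of_cols (dim_col M) (map v [1..<Suc r]))"

(* For U1, U2 with r orthonormal columns; the i-th angle has cosine sigma_i(U1^T U2). *)
definition principal_angle :: "real mat \<Rightarrow> real mat \<Rightarrow> nat \<Rightarrow> real" where
  "principal_angle U1 U2 i = arccos (singular_value (transpose_mat U1 * U2) i)"

(* mat_diag counts diagonal positions from 0. *)
definition sin_Theta :: "real mat \<Rightarrow> real mat \<Rightarrow> real mat" where
  "sin_Theta U1 U2 = mat_diag (dim_col U1) (\<lambda>i. sin (principal_angle U1 U2 (Suc i)))"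

definition sin_Theta_dist :: "ereal \<Rightarrow> real mat \<Rightarrow> real mat \<Rightarrow> real" where
  "sin_Theta_dist q U1 U2 = schatten_norm q (sin_Theta U1 U2)"

end

theory Submission
  imports Defs
begin

text \<open>The argument is variational.  Call a family \<open>x 1, ..., x k\<close> Bessel if \<open>\<Sum>i. (x i \<bullet> a)\<^sup>2 \<le> a \<bullet> a\<close> for all
  \<open>a\<close>.  For a matrix \<open>M\<close> with singular values \<open>s\<close> and Bessel families \<open>x, y\<close> of length \<open>k\<close>,
  \<open>\<Sum>i. \<bar>(x i)\<^sup>T M (y i)\<bar>\<^sup>p\<close> is at most the sum of the \<open>p\<close>-th powers of the \<open>k\<close> largest singular values
  (\<open>bessel_pairing_powr_le\<close>).

  Let \<open>P\<close> be the projection onto the orthogonal complement of the leading left singular vectors of \<open>B\<close>,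
  and let \<open>w\<close> be an eigenbasis of \<open>U\<^sup>T Uh Uh\<^sup>T U\<close>, which exists by the spectral theorem.  The vectors
  \<open>P U (w i)\<close> are mutually orthogonal, and their norms are the sines of the principal angles
  (\<open>sin_Theta_dist_spectrum\<close>).  Normalising them gives a Bessel family \<open>x\<close>; multiplying the \<open>j\<close>-th
  coordinate of \<open>w i\<close> by \<open>\<sigma>\<^sub>r(A) / \<sigma>\<^sub>j(A)\<close> and applying \<open>V\<close> gives another Bessel family \<open>y\<close>, for which
  \<open>\<sigma>\<^sub>r(A)\<close> times the \<open>i\<close>-th sine equals \<open>(x i)\<^sup>T A (y i) = (x i)\<^sup>T P B (y i) - (x i)\<^sup>T Z (y i)\<close>
  (\<open>sines_eq_residual\<close>).

  By the variational bound the \<open>Z\<close> part contributes at most the norm of the truncation of \<open>Z\<close>.  The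
  singular values of \<open>P B\<close> are \<open>\<sigma>\<^sub>r\<^sub>+\<^sub>j(B)\<close>, and since \<open>A\<close> has rank \<open>r\<close> Weyl's inequality bounds them by
  \<open>\<sigma>\<^sub>j(Z)\<close> (\<open>weyl\<close>), so the other part contributes the same amount (\<open>residual_powr_le\<close>).  For \<open>q = \<infinity>\<close>
  the same bounds are applied to a single pair \<open>(x i, y i)\<close> with \<open>p = 1\<close>.  Exchanging left and
  right singular vectors gives the bound for the right subspaces.\<close>

section \<open>Linear combinations, orthonormal families and Bessel families\<close>

text \<open>The linear combination \<open>c 1 x 1 + ... + c k x k\<close> of vectors of dimension \<open>d\<close>.  It is defined
  coordinatewise, so that no membership conditions are needed to form it.\<close>
definition comb :: "nat \<Rightarrow> nat \<Rightarrow> (nat \<Rightarrow> real) \<Rightarrow> (nat \<Rightarrow> real vec) \<Rightarrow> real vec" where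
  "comb d k c x = vec d (\<lambda>l. \<Sum>i = 1..k. c i * x i $ l)"

lemma comb_carrier [simp]: "comb d k c x \<in> carrier_vec d"
  by (simp add: comb_def)

lemma scalar_prod_comb_right:
  assumes "\<And>i. i \<in> {1..k} \<Longrightarrow> x i \<in> carrier_vec d"
  shows "a \<bullet> comb d k c x = (\<Sum>i = 1..k. c i * (a \<bullet> x i))"
proof -
  have "a \<bullet> comb d k c x = (\<Sum>l = 0..<d. \<Sum>i = 1..k. c i * (a $ l * x i $ l))"
    by (simp add: scalar_prod_def comb_def sum_distrib_left algebra_simps)
  also have "\<dots> = (\<Sum>i = 1..k. \<Sum>l = 0..<d. c i * (a $ l * x i $ l))"
    by (rule sum.swap)
  also have "\<dots> = (\<Sum>i = 1..k. c i * (a \<bullet> x i))"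
  proof (rule sum.cong[OF refl])
    fix i assume "i \<in> {1..k}"
    then have "dim_vec (x i) = d" using assms by auto
    then show "(\<Sum>l = 0..<d. c i * (a $ l * x i $ l)) = c i * (a \<bullet> x i)"
      by (simp add: scalar_prod_def sum_distrib_left)
  qed
  finally show ?thesis .
qed

lemma scalar_prod_comb_left:
  assumes "\<And>i. i \<in> {1..k} \<Longrightarrow> x i \<in> carrier_vec d" and "a \<in> carrier_vec d"
  shows "comb d k c x \<bullet> a = (\<Sum>i = 1..k. c i * (x i \<bullet> a))"
proof -
  have "comb d k c x \<bullet> a = a \<bullet> comb d k c x"
    using assms(2) by (intro comm_scalar_prod[of _ d]) auto
  also have "\<dots> = (\<Sum>i = 1..k. c i * (a \<bullet> x i))"
    using assms(1) by (rule scalar_prod_comb_right)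
  also have "\<dots> = (\<Sum>i = 1..k. c i * (x i \<bullet> a))"
    using assms by (intro sum.cong refl) (auto intro!: comm_scalar_prod[of _ d])
  finally show ?thesis .
qed

lemma orthonormal_carrier:
  "orthonormal_upto d k u \<Longrightarrow> i \<in> {1..k} \<Longrightarrow> u i \<in> carrier_vec d"
  by (auto simp: orthonormal_upto_def)

lemma orthonormal_prod:
  "orthonormal_upto d k u \<Longrightarrow> i \<in> {1..k} \<Longrightarrow> j \<in> {1..k} \<Longrightarrow> u i \<bullet> u j = (if i = j then 1 else 0)"
  by (auto simp: orthonormal_upto_def)

lemma orthonormal_mono:
  "orthonormal_upto d k u \<Longrightarrow> l \<le> k \<Longrightarrow> orthonormal_upto d l u"
  by (auto simp: orthonormal_upto_def)

lemma scalar_prod_comb_orthonormal: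
  assumes "orthonormal_upto d k u" and "i \<in> {1..k}" "l \<le> k"
  shows "u i \<bullet> comb d l c u = (if i \<le> l then c i else 0)"
proof -
  have "u i \<bullet> comb d l c u = (\<Sum>j = 1..l. c j * (u i \<bullet> u j))"
    using assms by (intro scalar_prod_comb_right) (auto simp: orthonormal_upto_def)
  also have "\<dots> = (\<Sum>j = 1..l. if j = i then c j else 0)"
    using assms by (intro sum.cong refl) (auto simp: orthonormal_prod[OF assms(1)])
  also have "\<dots> = (if i \<le> l then c i else 0)"
    using assms by (simp add: sum.delta)
  finally show ?thesis .
qed

lemma comb_orthonormal_prod:
  assumes "orthonormal_upto d k u"
  shows "comb d k c u \<bullet> comb d k e u = (\<Sum>i = 1..k. c i * e i)"
proof -
  have "comb d k c u \<bullet> comb d k e u = (\<Sum>i = 1..k. c i * (u i \<bullet> comb d k e u))"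
    using assms by (intro scalar_prod_comb_left) (auto simp: orthonormal_upto_def)
  also have "\<dots> = (\<Sum>i = 1..k. c i * e i)"
    using assms by (intro sum.cong refl) (auto simp: scalar_prod_comb_orthonormal)
  finally show ?thesis .
qed

text \<open>A family \<open>x 1, ..., x k\<close> satisfying Bessel's inequality, that is, the columns of a matrix of
  operator norm at most 1.  Orthonormal families have this property, and so do their images under
  contractions, which is why it replaces orthonormality below.\<close>
definition bessel :: "nat \<Rightarrow> nat \<Rightarrow> (nat \<Rightarrow> real vec) \<Rightarrow> bool" where
  "bessel d k x \<longleftrightarrow>
     (\<forall>i\<in>{1..k}. x i \<in> carrier_vec d) \<and>
     (\<forall>a\<in>carrier_vec d. (\<Sum>i = 1..k. (x i \<bullet> a)\<^sup>2) \<le> a \<bullet> a)"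

lemma besselD:
  assumes "bessel d k x"
  shows "\<And>i. i \<in> {1..k} \<Longrightarrow> x i \<in> carrier_vec d"
    and "\<And>a. a \<in> carrier_vec d \<Longrightarrow> (\<Sum>i = 1..k. (x i \<bullet> a)\<^sup>2) \<le> a \<bullet> a"
    and "\<And>a. a \<in> carrier_vec d \<Longrightarrow> (\<Sum>i = 1..k. (a \<bullet> x i)\<^sup>2) \<le> a \<bullet> a"
proof -
  show 1: "\<And>i. i \<in> {1..k} \<Longrightarrow> x i \<in> carrier_vec d"
    and 2: "\<And>a. a \<in> carrier_vec d \<Longrightarrow> (\<Sum>i = 1..k. (x i \<bullet> a)\<^sup>2) \<le> a \<bullet> a"
    using assms by (auto simp: bessel_def)
  fix a :: "real vec" assume a: "a \<in> carrier_vec d"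
  have "(\<Sum>i = 1..k. (a \<bullet> x i)\<^sup>2) = (\<Sum>i = 1..k. (x i \<bullet> a)\<^sup>2)"
  proof (rule sum.cong[OF refl])
    fix i assume "i \<in> {1..k}"
    then show "(a \<bullet> x i)\<^sup>2 = (x i \<bullet> a)\<^sup>2"
      using comm_scalar_prod[OF a 1] by simp
  qed
  then show "(\<Sum>i = 1..k. (a \<bullet> x i)\<^sup>2) \<le> a \<bullet> a" using 2[OF a] by simp
qed

text \<open>Bessel's inequality for the vector \<open>x i\<close> itself gives \<open>(x i \<bullet> x i)\<^sup>2 \<le> x i \<bullet> x i\<close>.\<close>
lemma bessel_norm_le:
  assumes "bessel d k x" and "i \<in> {1..k}"
  shows "x i \<bullet> x i \<le> 1"
proof -
  have x: "x i \<in> carrier_vec d" using besselD(1)[OF assms] .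
  have "(x i \<bullet> x i)\<^sup>2 \<le> (\<Sum>j = 1..k. (x j \<bullet> x i)\<^sup>2)"
    using assms(2) by (intro member_le_sum) auto
  also have "\<dots> \<le> x i \<bullet> x i" using besselD(2)[OF assms(1) x] .
  finally have "(x i \<bullet> x i) * (x i \<bullet> x i) \<le> 1 * (x i \<bullet> x i)" by (simp add: power2_eq_square)
  then show ?thesis
    by (meson mult_le_cancel_right not_le order_trans zero_le_one)
qed

lemma scalar_prod_self_nonneg: "0 \<le> (a :: real vec) \<bullet> a"
  by (simp add: scalar_prod_def sum_nonneg)

text \<open>Pairwise orthogonality together with norms at most 1 suffices; in particular zero vectors are
  permitted.\<close>
lemma bessel_if_orthogonal:
  assumes x: "\<And>i. i \<in> {1..k} \<Longrightarrow> x i \<in> carrier_vec d"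
    and orth: "\<And>i j. i \<in> {1..k} \<Longrightarrow> j \<in> {1..k} \<Longrightarrow> i \<noteq> j \<Longrightarrow> x i \<bullet> x j = 0"
    and norm: "\<And>i. i \<in> {1..k} \<Longrightarrow> x i \<bullet> x i \<le> 1"
  shows "bessel d k x"
  unfolding bessel_def
proof (intro conjI ballI)
  fix a :: "real vec" assume a: "a \<in> carrier_vec d"
  define c where "c = (\<lambda>i. x i \<bullet> a)"
  define p where "p = comb d k c x"
  have p: "p \<in> carrier_vec d" by (simp add: p_def)
  have pa: "p \<bullet> a = (\<Sum>i = 1..k. (c i)\<^sup>2)"
    unfolding p_def using scalar_prod_comb_left[OF x a] by (simp add: c_def power2_eq_square)
  have "p \<bullet> p = (\<Sum>i = 1..k. c i * (x i \<bullet> p))"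
    using scalar_prod_comb_left[OF x p, of k "\<lambda>i. i" c] by (simp add: p_def)
  also have "\<dots> = (\<Sum>i = 1..k. c i * (c i * (x i \<bullet> x i)))"
  proof (rule sum.cong[OF refl])
    fix i assume i: "i \<in> {1..k}"
    have "x i \<bullet> p = (\<Sum>j = 1..k. c j * (x i \<bullet> x j))"
      unfolding p_def by (rule scalar_prod_comb_right[OF x])
    also have "\<dots> = (\<Sum>j = 1..k. if j = i then c i * (x i \<bullet> x i) else 0)"
      using i orth by (intro sum.cong refl) auto
    finally show "c i * (x i \<bullet> p) = c i * (c i * (x i \<bullet> x i))" using i by simp
  qed
  also have "\<dots> \<le> (\<Sum>i = 1..k. (c i)\<^sup>2)"
  proof (rule sum_mono)
    fix i assume "i \<in> {1..k}"
    then have "(c i)\<^sup>2 * (x i \<bullet> x i) \<le> (c i)\<^sup>2 * 1" using norm by (intro mult_left_mono) auto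
    then show "c i * (c i * (x i \<bullet> x i)) \<le> (c i)\<^sup>2" by (simp add: power2_eq_square)
  qed
  finally have pp: "p \<bullet> p \<le> p \<bullet> a" using pa by simp
  have "0 \<le> (a - p) \<bullet> (a - p)" by (rule scalar_prod_self_nonneg)
  also have "\<dots> = a \<bullet> a - p \<bullet> a - (a \<bullet> p - p \<bullet> p)"
    using a p by (simp add: minus_scalar_prod_distrib scalar_prod_minus_distrib)
  also have "a \<bullet> p = p \<bullet> a" using a p by (rule comm_scalar_prod)
  finally show "(\<Sum>i = 1..k. (x i \<bullet> a)\<^sup>2) \<le> a \<bullet> a" using pp pa by (simp add: c_def)
qed (use x in auto)

lemma bessel_if_orthonormal: "orthonormal_upto d k u \<Longrightarrow> bessel d k u"
  by (rule bessel_if_orthogonal) (auto simp: orthonormal_upto_def)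

section \<open>Convexity and rearrangement inequalities\<close>

text \<open>The graph of \<open>t powr q\<close> lies above its tangent at 1, which for \<open>t > 0\<close> and \<open>y > 0\<close> follows from
  \<open>ln x \<le> x - 1\<close> at \<open>x = y / t\<close> and \<open>x = 1 / t\<close>, where \<open>y\<close> is the value of the tangent.\<close>
lemma powr_ge_tangent:
  fixes t q :: real
  assumes "0 \<le> t" and "1 \<le> q"
  shows "1 + q * (t - 1) \<le> t powr q"
proof (cases "t = 0 \<or> 1 + q * (t - 1) \<le> 0")
  case True
  then show ?thesis using assms by (auto intro: order_trans)
next
  case False
  define y where "y = 1 + q * (t - 1)"
  have t: "0 < t" and y: "0 < y" using False assms by (auto simp: y_def)
  have "ln (y / t) \<le> y / t - 1" using t y by (intro ln_le_minus_one) auto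
  moreover have "(q - 1) * ln (1 / t) \<le> (q - 1) * (1 / t - 1)"
    using t assms(2) by (intro mult_left_mono ln_le_minus_one) auto
  ultimately have "ln (y / t) + (q - 1) * ln (1 / t) \<le> (y / t - 1) + (q - 1) * (1 / t - 1)" by linarith
  also have "\<dots> = 0" using t by (simp add: y_def field_simps)
  finally have "ln y \<le> q * ln t"
    using t y by (simp add: ln_div algebra_simps)
  then have "exp (ln y) \<le> exp (q * ln t)" by simp
  then have "y \<le> exp (q * ln t)" using y by simp
  then show ?thesis using t by (simp add: powr_def y_def)
qed

text \<open>Jensen's inequality for the power function.  The total weight may be smaller than 1 because the
  function vanishes at 0.\<close>
lemma powr_weighted_sum_le:
  fixes s w :: "'a \<Rightarrow> real" and q :: real
  assumes q: "1 \<le> q"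
    and s: "\<And>j. j \<in> J \<Longrightarrow> 0 \<le> s j" and w: "\<And>j. j \<in> J \<Longrightarrow> 0 \<le> w j" and W: "sum w J \<le> 1"
  shows "(\<Sum>j\<in>J. s j * w j) powr q \<le> (\<Sum>j\<in>J. s j powr q * w j)"
proof (cases "(\<Sum>j\<in>J. s j * w j) = 0")
  case True
  then show ?thesis using s w by (auto intro!: sum_nonneg)
next
  case False
  define S where "S = (\<Sum>j\<in>J. s j * w j)"
  have "0 \<le> S" unfolding S_def using s w by (auto intro!: sum_nonneg)
  then have S: "0 < S" using False by (simp add: S_def)
  have "1 \<le> (1 - q) * sum w J + q"
    using mult_left_mono_neg[OF W, of "1 - q"] q by simp
  also have "\<dots> = (1 - q) * sum w J + q * (S / S)" using S by simp
  also have "\<dots> = (\<Sum>j\<in>J. (1 + q * (s j / S - 1)) * w j)"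
  proof -
    have "S / S = (\<Sum>j\<in>J. s j / S * w j)"
      by (subst (1) S_def) (simp add: sum_divide_distrib)
    then have "(1 - q) * sum w J + q * (S / S) = (\<Sum>j\<in>J. (1 - q) * w j + q * (s j / S * w j))"
      by (simp add: sum.distrib sum_distrib_left)
    then show ?thesis by (simp add: algebra_simps)
  qed
  also have "\<dots> \<le> (\<Sum>j\<in>J. (s j / S) powr q * w j)"
    using s w S q by (intro sum_mono mult_right_mono powr_ge_tangent) auto
  also have "\<dots> = (\<Sum>j\<in>J. s j powr q * w j) / S powr q"
    using S s by (simp add: powr_divide sum_divide_distrib)
  finally show ?thesis using S by (simp add: S_def field_simps)
qed

lemma abs_add_powr_le:
  fixes a b q :: real
  assumes "1 \<le> q"
  shows "\<bar>a + b\<bar> powr q \<le> 2 powr q * ((\<bar>a\<bar> powr q + \<bar>b\<bar> powr q) / 2)"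
proof -
  have "(\<Sum>j\<in>{True, False}. (if j then \<bar>a\<bar> else \<bar>b\<bar>) * (1/2)) powr q
      \<le> (\<Sum>j\<in>{True, False}. (if j then \<bar>a\<bar> else \<bar>b\<bar>) powr q * (1/2))"
    using assms by (intro powr_weighted_sum_le) auto
  then have *: "((\<bar>a\<bar> + \<bar>b\<bar>) / 2) powr q \<le> (\<bar>a\<bar> powr q + \<bar>b\<bar> powr q) / 2"
    by (simp add: add_divide_distrib)
  have "\<bar>a + b\<bar> powr q \<le> (\<bar>a\<bar> + \<bar>b\<bar>) powr q" using assms by (intro powr_mono2) auto
  also have "\<dots> = 2 powr q * ((\<bar>a\<bar> + \<bar>b\<bar>) / 2) powr q" by (simp add: powr_divide)
  also have "\<dots> \<le> 2 powr q * ((\<bar>a\<bar> powr q + \<bar>b\<bar> powr q) / 2)" using * by (intro mult_left_mono) auto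
  finally show ?thesis .
qed

text \<open>A decreasing sequence, weighted with weights from \<open>[0, 1]\<close> of total mass at most \<open>k\<close>, sums to at
  most its first \<open>k\<close> terms.\<close>
lemma sum_decreasing_weighted_le:
  fixes t c :: "nat \<Rightarrow> real"
  assumes t: "\<And>j. j \<in> {1..N} \<Longrightarrow> 0 \<le> t j"
    and dec: "\<And>i j. 1 \<le> i \<Longrightarrow> i \<le> j \<Longrightarrow> j \<le> N \<Longrightarrow> t j \<le> t i"
    and c: "\<And>j. j \<in> {1..N} \<Longrightarrow> 0 \<le> c j" "\<And>j. j \<in> {1..N} \<Longrightarrow> c j \<le> 1"
    and C: "(\<Sum>j = 1..N. c j) \<le> real k" and k: "1 \<le> k"
  shows "(\<Sum>j = 1..N. t j * c j) \<le> (\<Sum>j = 1..min k N. t j)"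
proof (cases "N \<le> k")
  case True
  have "(\<Sum>j = 1..N. t j * c j) \<le> (\<Sum>j = 1..N. t j * 1)"
    using t c by (intro sum_mono mult_left_mono) auto
  then show ?thesis using True by (simp add: min_def)
next
  case False
  then have kN: "k < N" by simp
  have split: "sum f {1..N} = sum f {1..k} + sum f {Suc k..N}" for f :: "nat \<Rightarrow> real"
    using kN by (subst sum.union_disjoint[symmetric]) (auto intro!: sum.cong)
  have "(\<Sum>j = Suc k..N. t j * c j) \<le> (\<Sum>j = Suc k..N. t k * c j)"
    using c k by (intro sum_mono mult_right_mono dec) auto
  also have "\<dots> = t k * (\<Sum>j = Suc k..N. c j)" by (simp add: sum_distrib_left)
  also have "\<dots> \<le> t k * (real k - (\<Sum>j = 1..k. c j))"
    using C split[of c] t kN k by (intro mult_left_mono) auto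
  also have "\<dots> = (\<Sum>j = 1..k. t k * (1 - c j))"
    by (simp add: sum_distrib_left[symmetric] sum_subtractf)
  also have "\<dots> \<le> (\<Sum>j = 1..k. t j * (1 - c j))"
    using c kN by (intro sum_mono mult_right_mono dec) auto
  also have "\<dots> = (\<Sum>j = 1..k. t j) - (\<Sum>j = 1..k. t j * c j)"
    by (simp add: algebra_simps sum_subtractf)
  finally show ?thesis using split[of "\<lambda>j. t j * c j"] kN by (simp add: min_def)
qed

section \<open>The variational bound for the leading singular values\<close>

text \<open>Pairing the matrix \<open>\<Sum>j. s j u j (v j)\<^sup>T\<close> with \<open>k\<close> pairs of vectors from Bessel families yields an
  \<open>l\<^sup>p\<close> norm that does not exceed the one of the \<open>k\<close> largest coefficients \<open>s j\<close>.  Indeed the \<open>i\<close>-th pairing is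
  at most \<open>\<Sum>j. s j D i j\<close> with \<open>D i j = ((x i \<bullet> u j)\<^sup>2 + (v j \<bullet> y i)\<^sup>2) / 2\<close>, and \<open>D\<close> is doubly substochastic:
  Jensen's inequality is applied along its rows, and then the rearrangement bound to its column
  sums.\<close>
lemma bessel_pairing_powr_le:
  fixes s :: "nat \<Rightarrow> real"
  assumes x: "bessel m k x" and y: "bessel n k y" and u: "bessel m N u" and v: "bessel n N v"
    and s: "\<And>j. j \<in> {1..N} \<Longrightarrow> 0 \<le> s j"
    and dec: "\<And>i j. 1 \<le> i \<Longrightarrow> i \<le> j \<Longrightarrow> j \<le> N \<Longrightarrow> s j \<le> s i"
    and p: "1 \<le> p" and k: "1 \<le> k"
  shows "(\<Sum>i = 1..k. \<bar>\<Sum>j = 1..N. s j * (x i \<bullet> u j) * (v j \<bullet> y i)\<bar> powr p)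
           \<le> (\<Sum>j = 1..min k N. s j powr p)"
proof -
  define D where "D = (\<lambda>i j. ((x i \<bullet> u j)\<^sup>2 + (v j \<bullet> y i)\<^sup>2) / 2)"
  have D0: "0 \<le> D i j" for i j by (simp add: D_def)
  have row: "(\<Sum>j = 1..N. D i j) \<le> 1" if i: "i \<in> {1..k}" for i
  proof -
    have "(\<Sum>j = 1..N. D i j) = ((\<Sum>j = 1..N. (x i \<bullet> u j)\<^sup>2) + (\<Sum>j = 1..N. (v j \<bullet> y i)\<^sup>2)) / 2"
      by (simp add: D_def sum.distrib sum_divide_distrib[symmetric])
    also have "\<dots> \<le> (1 + 1) / 2"
      using besselD(3)[OF u besselD(1)[OF x i]] besselD(2)[OF v besselD(1)[OF y i]]
        bessel_norm_le[OF x i] bessel_norm_le[OF y i] by simp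
    finally show ?thesis by simp
  qed
  have col: "(\<Sum>i = 1..k. D i j) \<le> 1" if j: "j \<in> {1..N}" for j
  proof -
    have "(\<Sum>i = 1..k. D i j) = ((\<Sum>i = 1..k. (x i \<bullet> u j)\<^sup>2) + (\<Sum>i = 1..k. (v j \<bullet> y i)\<^sup>2)) / 2"
      by (simp add: D_def sum.distrib sum_divide_distrib[symmetric])
    also have "\<dots> \<le> (1 + 1) / 2"
      using besselD(2)[OF x besselD(1)[OF u j]] besselD(3)[OF y besselD(1)[OF v j]]
        bessel_norm_le[OF u j] bessel_norm_le[OF v j] by simp
    finally show ?thesis by simp
  qed
  have entry: "\<bar>\<Sum>j = 1..N. s j * (x i \<bullet> u j) * (v j \<bullet> y i)\<bar> \<le> (\<Sum>j = 1..N. s j * D i j)" for i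
  proof -
    have "\<bar>\<Sum>j = 1..N. s j * (x i \<bullet> u j) * (v j \<bullet> y i)\<bar>
        \<le> (\<Sum>j = 1..N. \<bar>s j * (x i \<bullet> u j) * (v j \<bullet> y i)\<bar>)" by (rule sum_abs)
    also have "\<dots> \<le> (\<Sum>j = 1..N. s j * D i j)"
    proof (rule sum_mono)
      fix j assume j: "j \<in> {1..N}"
      have "0 \<le> (\<bar>x i \<bullet> u j\<bar> - \<bar>v j \<bullet> y i\<bar>)\<^sup>2" by simp
      then have "\<bar>x i \<bullet> u j\<bar> * \<bar>v j \<bullet> y i\<bar> \<le> D i j"
        by (simp add: D_def power2_diff)
      then have "s j * (\<bar>x i \<bullet> u j\<bar> * \<bar>v j \<bullet> y i\<bar>) \<le> s j * D i j"
        using s[OF j] by (rule mult_left_mono)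
      then show "\<bar>s j * (x i \<bullet> u j) * (v j \<bullet> y i)\<bar> \<le> s j * D i j"
        using s[OF j] by (simp add: abs_mult mult.assoc)
    qed
    finally show ?thesis .
  qed
  have "(\<Sum>i = 1..k. \<bar>\<Sum>j = 1..N. s j * (x i \<bullet> u j) * (v j \<bullet> y i)\<bar> powr p)
      \<le> (\<Sum>i = 1..k. (\<Sum>j = 1..N. s j * D i j) powr p)"
    using entry p by (intro sum_mono powr_mono2) auto
  also have "\<dots> \<le> (\<Sum>i = 1..k. \<Sum>j = 1..N. s j powr p * D i j)"
    using p s D0 row by (intro sum_mono powr_weighted_sum_le) auto
  also have "\<dots> = (\<Sum>j = 1..N. s j powr p * (\<Sum>i = 1..k. D i j))"
    by (subst sum.swap) (simp add: sum_distrib_left)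
  also have "\<dots> \<le> (\<Sum>j = 1..min k N. s j powr p)"
  proof (rule sum_decreasing_weighted_le)
    show "(\<Sum>j = 1..N. \<Sum>i = 1..k. D i j) \<le> real k"
      using sum_mono[of "{1..k}" "\<lambda>i. \<Sum>j = 1..N. D i j" "\<lambda>_. 1"] row by (subst sum.swap) simp
    show "s j powr p \<le> s i powr p" if "1 \<le> i" "i \<le> j" "j \<le> N" for i j
      using that p dec s by (intro powr_mono2) auto
  qed (use D0 col k in \<open>auto intro!: sum_nonneg\<close>)
  finally show ?thesis .
qed

section \<open>Completion of orthonormal families\<close>

lemma sum_from_1_eq: "(\<Sum>l = Suc 0..N. g l) = (\<Sum>j = 0..<N. g (Suc j))" for g :: "nat \<Rightarrow> real"
  by (rule sum.reindex_bij_witness[of _ Suc "\<lambda>l. l - 1"]) auto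

lemma homogeneous_system_nontrivial:
  fixes f :: "nat \<Rightarrow> nat \<Rightarrow> real"
  assumes "K < N"
  obtains c where "\<exists>l\<in>{1..N}. c l \<noteq> 0" and "\<And>k. k \<in> {1..K} \<Longrightarrow> (\<Sum>l = 1..N. c l * f k l) = 0"
proof -
  \<comment> \<open>The system is padded with zero rows to a square matrix, whose determinant vanishes.\<close>
  define R where "R = (\<lambda>i. vec N (\<lambda>j. if i < K then f (Suc i) (Suc j) else 0))"
  define M where "M = mat\<^sub>r N N (\<lambda>i. if i = N - 1 then 0\<^sub>v N else R i)"
  have M: "M \<in> carrier_mat N N" by (simp add: M_def)
  have "det M = 0"
    unfolding M_def by (rule det_row_0) (use assms in \<open>auto simp: R_def\<close>)
  then obtain v where v: "v \<in> carrier_vec N" "v \<noteq> 0\<^sub>v N" "M *\<^sub>v v = 0\<^sub>v N"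
    using det_0_iff_vec_prod_zero_field[OF M] by auto
  show thesis
  proof (rule that[of "\<lambda>l. v $ (l - 1)"])
    obtain i where "i < N" "v $ i \<noteq> 0"
      using v(1,2) by (metis carrier_vecD eq_vecI index_zero_vec(1) index_zero_vec(2))
    then show "\<exists>l\<in>{1..N}. v $ (l - 1) \<noteq> 0" by (intro bexI[of _ "Suc i"]) auto
    fix k assume k: "k \<in> {1..K}"
    define i where "i = k - 1"
    have i: "i < K" "Suc i = k" "i < N" "i \<noteq> N - 1" using k assms by (auto simp: i_def)
    have "row M i \<bullet> v = (M *\<^sub>v v) $ i" using M i by simp
    also have "\<dots> = 0" using v(3) i by simp
    also have "row M i = R i" using i by (simp add: M_def R_def)
    finally have "(\<Sum>j = 0..<N. f k (Suc j) * v $ j) = 0"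
      using v(1) i by (simp add: scalar_prod_def R_def)
    then show "(\<Sum>l = 1..N. v $ (l - 1) * f k l) = 0"
      by (simp add: sum_from_1_eq mult.commute)
  qed
qed

lemma scalar_prod_self_eq_0_iff: "(a :: real vec) \<bullet> a = 0 \<longleftrightarrow> a = 0\<^sub>v (dim_vec a)"
  using conjugate_square_eq_0_vec[of a "dim_vec a"] by (simp add: vec_conjugate_real)

lemma orthonormal_extend:
  assumes u: "orthonormal_upto d k u" and "k < d"
  obtains e where "e \<in> carrier_vec d" "e \<bullet> e = 1" "\<And>i. i \<in> {1..k} \<Longrightarrow> u i \<bullet> e = 0"
proof -
  obtain c where c: "\<exists>l\<in>{1..d}. c l \<noteq> 0"
    "\<And>i. i \<in> {1..k} \<Longrightarrow> (\<Sum>l = 1..d. c l * u i $ (l - 1)) = 0"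
    using homogeneous_system_nontrivial[OF \<open>k < d\<close>, of "\<lambda>i l. u i $ (l - 1)"] by blast
  define a where "a = vec d (\<lambda>j. c (Suc j))"
  have a: "a \<in> carrier_vec d" by (simp add: a_def)
  have ua: "u i \<bullet> a = 0" if "i \<in> {1..k}" for i
    using c(2)[OF that] by (simp add: a_def scalar_prod_def sum_from_1_eq mult.commute)
  obtain l where l: "l \<in> {1..d}" "c l \<noteq> 0" using c(1) by blast
  then have "a $ (l - 1) \<noteq> 0" "l - 1 < d" by (auto simp: a_def)
  then have "a \<noteq> 0\<^sub>v d" by auto
  then have "a \<bullet> a \<noteq> 0" using a by (simp add: scalar_prod_self_eq_0_iff)
  then have aa: "0 < a \<bullet> a" using scalar_prod_self_nonneg[of a] by simp
  show thesis
  proof (rule that[of "(1 / sqrt (a \<bullet> a)) \<cdot>\<^sub>v a"])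
    show "((1 / sqrt (a \<bullet> a)) \<cdot>\<^sub>v a) \<bullet> ((1 / sqrt (a \<bullet> a)) \<cdot>\<^sub>v a) = 1"
      using aa by (simp add: field_simps)
    show "u i \<bullet> ((1 / sqrt (a \<bullet> a)) \<cdot>\<^sub>v a) = 0" if "i \<in> {1..k}" for i
      using ua[OF that] scalar_prod_smult_distrib[OF orthonormal_carrier[OF u that] a] by simp
  qed (use a in auto)
qed

lemma orthonormal_append:
  assumes u: "orthonormal_upto d k u" and e: "e \<in> carrier_vec d" "e \<bullet> e = 1"
    and ue: "\<And>i. i \<in> {1..k} \<Longrightarrow> u i \<bullet> e = 0"
  shows "orthonormal_upto d (Suc k) (u(Suc k := e))"
proof -
  have eu: "e \<bullet> u i = 0" if "i \<in> {1..k}" for i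
    using ue[OF that] comm_scalar_prod[OF e(1) orthonormal_carrier[OF u that]] by simp
  show ?thesis
    unfolding orthonormal_upto_def
  proof (intro conjI ballI)
    fix i j assume ij: "i \<in> {1..Suc k}" "j \<in> {1..Suc k}"
    show "(u(Suc k := e)) i \<bullet> (u(Suc k := e)) j = (if i = j then 1 else 0)"
      using ij e(2) ue[of i] eu[of j] orthonormal_prod[OF u, of i j]
      by (cases "i = Suc k"; cases "j = Suc k") auto
  next
    fix i assume "i \<in> {1..Suc k}"
    then show "(u(Suc k := e)) i \<in> carrier_vec d"
      using e(1) orthonormal_carrier[OF u, of i] by (cases "i = Suc k") auto
  qed
qed

lemma orthonormal_basis_extension:
  assumes "orthonormal_upto d k u" and "k \<le> d"
  obtains w where "orthonormal_upto d d w" and "\<And>i. i \<in> {1..k} \<Longrightarrow> w i = u i"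
proof -
  have "\<exists>w. orthonormal_upto d l w \<and> (\<forall>i\<in>{1..k}. w i = u i)" if "k \<le> l" "l \<le> d" for l
    using that
  proof (induction l rule: dec_induct)
    case base
    then show ?case using assms(1) by auto
  next
    case (step l)
    then obtain w where w: "orthonormal_upto d l w" "\<forall>i\<in>{1..k}. w i = u i" by auto
    obtain e where "e \<in> carrier_vec d" "e \<bullet> e = 1" "\<And>i. i \<in> {1..l} \<Longrightarrow> w i \<bullet> e = 0"
      using orthonormal_extend[OF w(1)] step.prems by auto
    then have "orthonormal_upto d (Suc l) (w(Suc l := e))" by (intro orthonormal_append[OF w(1)])
    moreover have "\<forall>i\<in>{1..k}. (w(Suc l := e)) i = u i" using w(2) step.hyps by auto
    ultimately show ?case by blast
  qed
  then show thesis using that assms(2) by blast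
qed

lemma mat_of_cols_upt:
  assumes "\<And>i. i \<in> {1..r} \<Longrightarrow> u i \<in> carrier_vec m"
  shows "mat_of_cols m (map u [1..<Suc r]) \<in> carrier_mat m r"
    and "j < r \<Longrightarrow> col (mat_of_cols m (map u [1..<Suc r])) j = u (Suc j)"
proof -
  show "mat_of_cols m (map u [1..<Suc r]) \<in> carrier_mat m r"
    by (metis length_map length_upt diff_Suc_1 mat_of_cols_carrier(1))
  show "col (mat_of_cols m (map u [1..<Suc r])) j = u (Suc j)" if "j < r"
    using that assms[of "Suc j"] by (subst col_mat_of_cols) (auto simp del: upt_Suc)
qed

lemma orthonormal_transpose_mult:
  assumes u: "orthonormal_upto m k u"
  defines "Q \<equiv> mat_of_cols m (map u [1..<Suc k])"
  shows "transpose_mat Q * Q = 1\<^sub>m k"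
proof -
  have Q: "Q \<in> carrier_mat m k" and col: "\<And>j. j < k \<Longrightarrow> col Q j = u (Suc j)"
    unfolding Q_def using mat_of_cols_upt[of k u m] orthonormal_carrier[OF u] by auto
  show ?thesis
  proof (rule eq_matI)
    fix i j assume "i < dim_row (1\<^sub>m k :: real mat)" "j < dim_col (1\<^sub>m k :: real mat)"
    then have ij: "i < k" "j < k" by auto
    then have "(transpose_mat Q * Q) $$ (i, j) = u (Suc i) \<bullet> u (Suc j)" using Q col by simp
    then show "(transpose_mat Q * Q) $$ (i, j) = 1\<^sub>m k $$ (i, j)"
      using ij orthonormal_prod[OF u, of "Suc i" "Suc j"] by simp
  qed (use Q in auto)
qed

lemma orthonormal_basis_matrix:
  assumes w: "orthonormal_upto d d w"
  defines "Q \<equiv> mat_of_cols d (map w [1..<Suc d])"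
  shows "Q \<in> carrier_mat d d" and "\<And>j. j < d \<Longrightarrow> col Q j = w (Suc j)"
    and "transpose_mat Q * Q = 1\<^sub>m d" and "Q * transpose_mat Q = 1\<^sub>m d"
proof -
  show Q: "Q \<in> carrier_mat d d"
    unfolding Q_def using mat_of_cols_upt(1)[of d w d] orthonormal_carrier[OF w] by auto
  show "col Q j = w (Suc j)" if "j < d" for j
    unfolding Q_def using mat_of_cols_upt(2)[of d w d j] orthonormal_carrier[OF w] that by blast
  show 1: "transpose_mat Q * Q = 1\<^sub>m d"
    unfolding Q_def by (rule orthonormal_transpose_mult[OF w])
  show "Q * transpose_mat Q = 1\<^sub>m d"
    using mat_mult_left_right_inverse[OF _ Q 1] Q by simp
qed

lemma eq_vec_if_orthonormal_basis:
  assumes w: "orthonormal_upto d d w" and a: "a \<in> carrier_vec d" and b: "b \<in> carrier_vec d"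
    and eq: "\<And>i. i \<in> {1..d} \<Longrightarrow> w i \<bullet> a = w i \<bullet> b"
  shows "a = b"
proof -
  define Q where "Q = mat_of_cols d (map w [1..<Suc d])"
  note Q = orthonormal_basis_matrix[OF w, folded Q_def]
  have "transpose_mat Q *\<^sub>v a = transpose_mat Q *\<^sub>v b"
    using Q(1,2) eq by (intro eq_vecI) auto
  then have "(Q * transpose_mat Q) *\<^sub>v a = (Q * transpose_mat Q) *\<^sub>v b"
    using Q(1) a b by simp
  then show ?thesis using Q(4) a b by simp
qed

section \<open>The spectral theorem for real symmetric matrices\<close>

lemma proots_char_poly_orthonormal_eigenbasis:
  fixes K :: "real mat"
  assumes K: "K \<in> carrier_mat n n" and w: "orthonormal_upto n n w"
    and eig: "\<And>i. i \<in> {1..n} \<Longrightarrow> K *\<^sub>v w i = d i \<cdot>\<^sub>v w i"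
  shows "proots (char_poly K) = mset (map d [1..<Suc n])"
proof -
  define Q where "Q = mat_of_cols n (map w [1..<Suc n])"
  note Q = orthonormal_basis_matrix[OF w, folded Q_def]
  define D where "D = mat_diag n (\<lambda>i. d (Suc i))"
  have D: "D \<in> carrier_mat n n" by (simp add: D_def)
  have "K * Q = Q * D"
  proof (rule eq_matI)
    fix i j assume "i < dim_row (Q * D)" "j < dim_col (Q * D)"
    then have ij: "i < n" "j < n" using Q(1) D by auto
    have wj: "dim_vec (w (Suc j)) = n" using orthonormal_carrier[OF w, of "Suc j"] ij by auto
    have "(K * Q) $$ (i, j) = (K *\<^sub>v w (Suc j)) $ i" using K Q(1,2) ij by simp
    also have "\<dots> = d (Suc j) * w (Suc j) $ i" using eig[of "Suc j"] ij wj by simp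
    also have "w (Suc j) $ i = Q $$ (i, j)" using Q(1) Q(2)[OF ij(2)] ij by (metis carrier_matD index_col)
    also have "d (Suc j) * Q $$ (i, j) = (Q * D) $$ (i, j)"
      using ij unfolding D_def by (simp add: mat_diag_mult_right[OF Q(1)])
    finally show "(K * Q) $$ (i, j) = (Q * D) $$ (i, j)" .
  qed (use K Q(1) D in auto)
  then have "Q * D * transpose_mat Q = K * Q * transpose_mat Q" by simp
  also have "\<dots> = K * (Q * transpose_mat Q)" using K Q(1) by (intro assoc_mult_mat) auto
  also have "\<dots> = K" using K Q(4) by simp
  finally have "similar_mat K D"
    using Q K D by (intro similar_matI[of _ _ Q "transpose_mat Q" n]) auto
  then have "char_poly K = char_poly D" by (rule char_poly_similar)
  also have "\<dots> = (\<Prod>a\<leftarrow>diag_mat D. [:- a, 1:])"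
    by (rule char_poly_upper_triangular[OF D]) (auto simp: D_def mat_diag_def)
  also have "diag_mat D = map d [1..<Suc n]"
    by (rule nth_equalityI) (auto simp: diag_mat_def D_def mat_diag_def simp del: upt_Suc)
  finally have "char_poly K = (\<Prod>a\<leftarrow>map d [1..<Suc n]. [:- a, 1:])" .
  moreover have "proots (\<Prod>a\<leftarrow>as. [:- a, 1:]) = mset as" for as :: "real list"
  proof (induction as)
    case (Cons a as)
    have "(\<Prod>a\<leftarrow>as. [:- a, 1:]) \<noteq> 0" by (auto simp: prod_list_zero_iff)
    then have "proots ([:- a, 1:] * (\<Prod>a\<leftarrow>as. [:- a, 1:])) = {#a#} + mset as"
      using Cons.IH by (subst proots_mult) auto
    then show ?case by simp
  qed simp
  ultimately show ?thesis by (simp only:)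
qed

text \<open>A complex eigenvalue exists by the fundamental theorem of algebra.  It is real because \<open>K\<close> is
  self-adjoint for the Hermitian product, hence it is a root of the real characteristic polynomial.\<close>
lemma symmetric_real_eigenvector:
  fixes K :: "real mat"
  assumes K: "K \<in> carrier_mat n n" and sym: "transpose_mat K = K" and n: "0 < n"
  obtains y e where "y \<in> carrier_vec n" "y \<noteq> 0\<^sub>v n" "K *\<^sub>v y = e \<cdot>\<^sub>v y"
proof -
  define C where "C = map_mat complex_of_real K"
  have C: "C \<in> carrier_mat n n" using K by (simp add: C_def)
  obtain as where as: "char_poly C = (\<Prod>a\<leftarrow>as. [:- a, 1:])" "length as = n"
    using char_poly_factorized[OF C] by blast
  then obtain a bs where "as = a # bs" using n by (cases as) auto
  then have root: "poly (char_poly C) a = 0" using as(1) by simp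
  then obtain v where v: "v \<in> carrier_vec n" "v \<noteq> 0\<^sub>v n" "C *\<^sub>v v = a \<cdot>\<^sub>v v"
    using eigenvalue_root_char_poly[OF C] C by (auto simp: eigenvalue_def eigenvector_def)
  have Ct: "transpose_mat C = C" using sym by (metis C_def map_mat_transpose)
  have Cv: "C *\<^sub>v conjugate v = conjugate (C *\<^sub>v v)"
    using C v(1) K by (intro eq_vecI) (auto simp: scalar_prod_def C_def sum_conjugate conjugate_dist_mul)
  have "a * (v \<bullet>c v) = (C *\<^sub>v v) \<bullet>c v" using v by simp
  also have "\<dots> = (transpose_mat C *\<^sub>v v) \<bullet> conjugate v" by (simp add: Ct)
  also have "\<dots> = v \<bullet> (C *\<^sub>v conjugate v)"
    using C v(1) by (intro transpose_vec_mult_scalar) auto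
  also have "\<dots> = v \<bullet> conjugate (a \<cdot>\<^sub>v v)" using Cv v(3) by simp
  also have "\<dots> = conjugate a * (v \<bullet>c v)" using v(1) by (simp add: conjugate_smult_vec)
  finally have "a = conjugate a" using v(1,2) by simp
  then have "a = complex_of_real (Re a)" by (simp add: complex_eq_iff)
  then obtain e where e: "a = complex_of_real e" by blast
  have "char_poly C = map_poly complex_of_real (char_poly K)"
    unfolding C_def using K by (rule of_real_hom.char_poly_hom)
  then have "poly (char_poly K) e = 0" using root e by simp
  then have "eigenvalue K e" using eigenvalue_root_char_poly[OF K] by simp
  then show thesis using that K by (auto simp: eigenvalue_def eigenvector_def)
qed

text \<open>The basis is built one vector at a time.  The orthogonal complement of the eigenvectors found so far
  is invariant under \<open>K\<close>, and the compression \<open>K'\<close> of \<open>K\<close> to it is again symmetric, so an eigenvector of \<open>K'\<close>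
  supplies the next eigenvector of \<open>K\<close>.\<close>
lemma symmetric_orthonormal_eigenbasis:
  fixes K :: "real mat"
  assumes K: "K \<in> carrier_mat n n" and sym: "transpose_mat K = K"
  obtains w d where "orthonormal_upto n n w" and "\<And>i. i \<in> {1..n} \<Longrightarrow> K *\<^sub>v w i = d i \<cdot>\<^sub>v w i"
proof -
  have self_adj: "(K *\<^sub>v a) \<bullet> b = a \<bullet> (K *\<^sub>v b)" if "a \<in> carrier_vec n" "b \<in> carrier_vec n" for a b
    using transpose_vec_mult_scalar[OF K that(2,1)] sym by simp
  have "\<exists>w d. orthonormal_upto n k w \<and> (\<forall>i\<in>{1..k}. K *\<^sub>v w i = d i \<cdot>\<^sub>v w i)" if "k \<le> n" for k
    using that
  proof (induction k)
    case 0
    show ?case by (auto simp: orthonormal_upto_def)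
  next
    case (Suc k)
    then obtain w d where w: "orthonormal_upto n k w"
      and eig: "\<And>i. i \<in> {1..k} \<Longrightarrow> K *\<^sub>v w i = d i \<cdot>\<^sub>v w i" by auto
    obtain b where b: "orthonormal_upto n n b" and bw: "\<And>i. i \<in> {1..k} \<Longrightarrow> b i = w i"
      using orthonormal_basis_extension[OF w] Suc.prems by auto
    define h where "h = n - k"
    define z where "z = (\<lambda>l. b (k + l))"
    have z: "orthonormal_upto n h z"
      using b Suc.prems by (auto simp: orthonormal_upto_def z_def h_def)
    have zc: "z l \<in> carrier_vec n" if "l \<in> {1..h}" for l using orthonormal_carrier[OF z that] .
    have wz: "w i \<bullet> z l = 0" if "i \<in> {1..k}" "l \<in> {1..h}" for i l
      using orthonormal_prod[OF b, of i "k + l"] bw[OF that(1)] that Suc.prems by (auto simp: z_def h_def)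
    \<comment> \<open>\<open>K'\<close> is indexed from 0, the family \<open>z\<close> from 1.\<close>
    define K' where "K' = mat h h (\<lambda>(i, j). (K *\<^sub>v z (Suc i)) \<bullet> z (Suc j))"
    have K': "K' \<in> carrier_mat h h" by (simp add: K'_def)
    have "transpose_mat K' = K'"
    proof (rule eq_matI)
      fix i j assume "i < dim_row K'" "j < dim_col K'"
      then have ij: "i < h" "j < h" using K' by auto
      then have zz: "z (Suc i) \<in> carrier_vec n" "z (Suc j) \<in> carrier_vec n" by (auto intro!: zc)
      have "(K *\<^sub>v z (Suc j)) \<bullet> z (Suc i) = z (Suc j) \<bullet> (K *\<^sub>v z (Suc i))" using zz by (simp add: self_adj)
      also have "\<dots> = (K *\<^sub>v z (Suc i)) \<bullet> z (Suc j)" using zz K by (intro comm_scalar_prod[of _ n]) auto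
      finally show "transpose_mat K' $$ (i, j) = K' $$ (i, j)" using ij by (simp add: K'_def)
    qed (auto simp: K'_def)
    then obtain y e where y: "y \<in> carrier_vec h" "y \<noteq> 0\<^sub>v h" "K' *\<^sub>v y = e \<cdot>\<^sub>v y"
      using symmetric_real_eigenvector[OF K'] Suc.prems by (auto simp: h_def)
    define x where "x = comb n h (\<lambda>l. y $ (l - 1)) z"
    have x: "x \<in> carrier_vec n" by (simp add: x_def)
    have wx: "w i \<bullet> x = 0" if "i \<in> {1..k}" for i
    proof -
      have "w i \<bullet> x = (\<Sum>l = 1..h. y $ (l - 1) * (w i \<bullet> z l))"
        unfolding x_def by (rule scalar_prod_comb_right[OF zc])
      then show ?thesis using wz[OF that] by simp
    qed
    have Kx: "K *\<^sub>v x = e \<cdot>\<^sub>v x"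
    proof (rule eq_vec_if_orthonormal_basis[OF b])
      fix i assume i: "i \<in> {1..n}"
      have bi: "b i \<in> carrier_vec n" using orthonormal_carrier[OF b i] .
      show "b i \<bullet> (K *\<^sub>v x) = b i \<bullet> (e \<cdot>\<^sub>v x)"
      proof (cases "i \<le> k")
        case True
        then have ik: "i \<in> {1..k}" using i by auto
        have wi: "w i \<in> carrier_vec n" using orthonormal_carrier[OF w ik] .
        have "w i \<bullet> (K *\<^sub>v x) = (K *\<^sub>v w i) \<bullet> x" using wi x by (simp add: self_adj)
        also have "\<dots> = 0" using wi x wx[OF ik] by (simp add: eig[OF ik])
        finally show ?thesis using wi x wx[OF ik] bw[OF ik] by simp
      next
        case False
        define l where "l = i - k"
        have l: "l \<in> {1..h}" "l - 1 < h" "Suc (l - 1) = l" "b i = z l" using False i by (auto simp: l_def h_def z_def)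
        have "z l \<bullet> (K *\<^sub>v x) = (K *\<^sub>v z l) \<bullet> x" using zc[OF l(1)] x by (simp add: self_adj)
        also have "\<dots> = (\<Sum>j = 1..h. y $ (j - 1) * ((K *\<^sub>v z l) \<bullet> z j))"
          unfolding x_def by (rule scalar_prod_comb_right[OF zc])
        also have "\<dots> = (K' *\<^sub>v y) $ (l - 1)"
          using l y(1) K' by (simp add: sum_from_1_eq scalar_prod_def K'_def mult.commute)
        also have "\<dots> = e * y $ (l - 1)" using y(1,3) l by simp
        also have "y $ (l - 1) = z l \<bullet> x"
          unfolding x_def using scalar_prod_comb_orthonormal[OF z l(1) le_refl] l by simp
        finally show ?thesis using zc[OF l(1)] x l(4) by simp
      qed
    qed (use K x in auto)
    have "x \<bullet> x = y \<bullet> y"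
      unfolding x_def comb_orthonormal_prod[OF z]
      using y(1) by (simp add: sum_from_1_eq scalar_prod_def)
    then have "x \<bullet> x \<noteq> 0" using y(1,2) scalar_prod_self_eq_0_iff[of y] by auto
    then have xx: "0 < x \<bullet> x" using scalar_prod_self_nonneg[of x] by simp
    define f where "f = (1 / sqrt (x \<bullet> x)) \<cdot>\<^sub>v x"
    have f: "f \<in> carrier_vec n" "f \<bullet> f = 1" using x xx by (auto simp: f_def field_simps)
    have "K *\<^sub>v f = (1 / sqrt (x \<bullet> x)) \<cdot>\<^sub>v (K *\<^sub>v x)" unfolding f_def using K x by (rule mult_mat_vec)
    also have "\<dots> = e \<cdot>\<^sub>v f" by (simp add: Kx f_def smult_smult_assoc mult.commute)
    finally have Kf: "K *\<^sub>v f = e \<cdot>\<^sub>v f" .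
    have wf: "w i \<bullet> f = 0" if "i \<in> {1..k}" for i
      using wx[OF that] scalar_prod_smult_distrib[OF orthonormal_carrier[OF w that] x] by (simp add: f_def)
    have "orthonormal_upto n (Suc k) (w(Suc k := f))" by (rule orthonormal_append[OF w f wf])
    moreover have "\<forall>i\<in>{1..Suc k}. K *\<^sub>v (w(Suc k := f)) i = (d(Suc k := e)) i \<cdot>\<^sub>v (w(Suc k := f)) i"
      using eig Kf by (auto simp: le_Suc_eq)
    ultimately show ?case by blast
  qed
  then show thesis using that by blast
qed

section \<open>Singular values of sums of outer products\<close>

text \<open>If \<open>M\<^sup>T M\<close> has the eigenvalues \<open>d 1, ..., d n\<close> with multiplicity, then \<open>singular_value M\<close> on
  \<open>1, ..., n\<close> is the decreasing rearrangement of their square roots.\<close>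
context
  fixes M :: "real mat" and d :: "nat \<Rightarrow> real" and n :: nat
  assumes spectrum: "proots (char_poly (transpose_mat M * M)) = mset (map d [1..<Suc n])"
begin

text \<open>The eigenvalues in decreasing order.\<close>
private definition "L = rev (sorted_list_of_multiset (mset (map d [1..<Suc n])))"

private lemma L: "length L = n" "mset L = mset (map d [1..<Suc n])" "singular_value M i = sqrt (L ! (i - 1))"
proof -
  show *: "mset L = mset (map d [1..<Suc n])" by (simp only: L_def mset_rev mset_sorted_list_of_multiset)
  show "length L = n" using arg_cong[OF *, of size] by simp
  show "singular_value M i = sqrt (L ! (i - 1))" unfolding singular_value_def spectrum L_def ..
qed

lemma sum_singular_values: "(\<Sum>i = 1..n. f (singular_value M i)) = (\<Sum>i = 1..n. f (sqrt (d i)))"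
  for f :: "real \<Rightarrow> real"
proof -
  have "(\<Sum>i = 1..n. f (singular_value M i)) = (\<Sum>i = 0..<n. f (sqrt (L ! i)))"
    by (simp add: L(3) sum_from_1_eq)
  also have "\<dots> = sum_list (map (\<lambda>x. f (sqrt x)) L)"
    by (simp add: sum_list_sum_nth L(1))
  also have "\<dots> = sum_mset (image_mset (\<lambda>x. f (sqrt x)) (mset L))"
    by (metis mset_map sum_mset_sum_list)
  also have "\<dots> = sum_mset (image_mset (\<lambda>x. f (sqrt x)) (mset (map d [1..<Suc n])))" by (simp only: L(2))
  also have "\<dots> = sum_list (map (\<lambda>i. f (sqrt (d i))) [1..<Suc n])"
    by (simp only: mset_map[symmetric] sum_mset_sum_list map_map o_def)
  also have "\<dots> = (\<Sum>i = 1..n. f (sqrt (d i)))"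
    by (simp only: sum_list_distinct_conv_sum_set distinct_upt set_upt atLeastLessThanSuc_atLeastAtMost)
  finally show ?thesis .
qed

lemma singular_value_in_spectrum:
  assumes "i \<in> {1..n}"
  obtains k where "k \<in> {1..n}" "singular_value M i = sqrt (d k)"
proof -
  have "L ! (i - 1) \<in> set L" using assms L(1) by (intro nth_mem) auto
  also have "set L = d ` {1..n}"
    using arg_cong[OF L(2), of set_mset] by (simp only: set_mset_mset set_map set_upt atLeastLessThanSuc_atLeastAtMost)
  finally show thesis using that L(3) by auto
qed

lemma singular_value_antimono:
  assumes "1 \<le> i" "i \<le> j" "j \<le> n"
  shows "singular_value M j \<le> singular_value M i"
proof -
  have "sorted (rev L)" by (simp add: L_def)
  then have "L ! (j - 1) \<le> L ! (i - 1)"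
    using assms L(1) by (intro sorted_rev_nth_mono) auto
  then show ?thesis by (simp add: L(3))
qed

lemma singular_value_eq:
  assumes dec: "\<And>i j. 1 \<le> i \<Longrightarrow> i \<le> j \<Longrightarrow> j \<le> n \<Longrightarrow> d j \<le> d i" and i: "i \<in> {1..n}"
  shows "singular_value M i = sqrt (d i)"
proof -
  define ds where "ds = map d [1..<Suc n]"
  have "sorted (rev ds)"
    unfolding sorted_rev_iff_nth_mono using dec by (auto simp: ds_def simp del: upt_Suc)
  then have "sort ds = rev ds" by (intro properties_for_sort) auto
  then have "L = ds" by (simp only: L_def ds_def[symmetric] sorted_list_of_multiset_mset rev_rev_ident)
  moreover have "ds ! (i - 1) = d (1 + (i - 1))"
    unfolding ds_def using i by (intro nth_map_upt) auto
  ultimately show ?thesis using i L(3)[of i] by simp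
qed

end

text \<open>The matrix \<open>s 1 u 1 (v 1)\<^sup>T + ... + s N u N (v N)\<^sup>T\<close> of size \<open>m \<times> n\<close>, with arbitrary coefficients: neither
  their order nor their sign is prescribed.\<close>
definition outer_sum ::
  "nat \<Rightarrow> nat \<Rightarrow> nat \<Rightarrow> (nat \<Rightarrow> real) \<Rightarrow> (nat \<Rightarrow> real vec) \<Rightarrow> (nat \<Rightarrow> real vec) \<Rightarrow> real mat" where
  "outer_sum m n N s u v = mat m n (\<lambda>(a, b). \<Sum>i = 1..N. s i * (u i $ a) * (v i $ b))"

lemma outer_sum_carrier [simp]: "outer_sum m n N s u v \<in> carrier_mat m n"
  by (simp add: outer_sum_def)

lemma svd_sum_eq_outer_sum:
  "svd_sum M u v r = outer_sum (dim_row M) (dim_col M) r (singular_value M) u v"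
  by (simp add: svd_sum_def outer_sum_def)

lemma transpose_outer_sum: "transpose_mat (outer_sum m n N s u v) = outer_sum n m N s v u"
  by (rule eq_matI) (auto simp: outer_sum_def algebra_simps)

lemma outer_sum_mult_vec:
  assumes y: "y \<in> carrier_vec n" and v: "\<And>i. i \<in> {1..N} \<Longrightarrow> v i \<in> carrier_vec n"
  shows "outer_sum m n N s u v *\<^sub>v y = comb m N (\<lambda>j. s j * (v j \<bullet> y)) u"
proof (rule eq_vecI)
  fix a assume "a < dim_vec (comb m N (\<lambda>j. s j * (v j \<bullet> y)) u)"
  then have a: "a < m" by (simp add: comb_def)
  have "(outer_sum m n N s u v *\<^sub>v y) $ a = (\<Sum>b = 0..<n. \<Sum>j = 1..N. s j * u j $ a * (v j $ b * y $ b))"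
    using a y by (simp add: outer_sum_def scalar_prod_def sum_distrib_right sum_distrib_left algebra_simps)
  also have "\<dots> = (\<Sum>j = 1..N. \<Sum>b = 0..<n. s j * u j $ a * (v j $ b * y $ b))" by (rule sum.swap)
  also have "\<dots> = (\<Sum>j = 1..N. s j * (v j \<bullet> y) * u j $ a)"
    using y by (simp add: scalar_prod_def sum_distrib_left sum_distrib_right mult.commute mult.left_commute)
  finally show "(outer_sum m n N s u v *\<^sub>v y) $ a = comb m N (\<lambda>j. s j * (v j \<bullet> y)) u $ a"
    using a by (simp add: comb_def)
qed (simp add: outer_sum_def comb_def)

lemma scalar_prod_outer_sum:
  assumes "y \<in> carrier_vec n"
    and v: "\<And>i. i \<in> {1..N} \<Longrightarrow> v i \<in> carrier_vec n" and u: "\<And>i. i \<in> {1..N} \<Longrightarrow> u i \<in> carrier_vec m"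
  shows "x \<bullet> (outer_sum m n N s u v *\<^sub>v y) = (\<Sum>j = 1..N. s j * (x \<bullet> u j) * (v j \<bullet> y))"
  by (subst outer_sum_mult_vec[OF assms(1) v], assumption, subst scalar_prod_comb_right[OF u], assumption)
    (simp add: mult.commute mult.left_commute)

text \<open>For orthonormal families \<open>u\<close> and \<open>v\<close>, the vectors \<open>v i\<close>, completed to a basis, are eigenvectors of the
  Gram matrix, with eigenvalues \<open>(s i)\<^sup>2\<close> for \<open>i \<le> N\<close> and 0 beyond.\<close>
lemma proots_gram_outer_sum:
  assumes u: "orthonormal_upto m N u" and v: "orthonormal_upto n N v" and N: "N \<le> n"
  shows "proots (char_poly (transpose_mat (outer_sum m n N s u v) * outer_sum m n N s u v))
           = mset (map (\<lambda>i. if i \<le> N then (s i)\<^sup>2 else 0) [1..<Suc n])"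
proof -
  obtain w where w: "orthonormal_upto n n w" "\<And>i. i \<in> {1..N} \<Longrightarrow> w i = v i"
    using orthonormal_basis_extension[OF v N] by blast
  note uc = orthonormal_carrier[OF u] and vc = orthonormal_carrier[OF v]
  show ?thesis
  proof (rule proots_char_poly_orthonormal_eigenbasis[OF _ w(1)])
    fix i assume i: "i \<in> {1..n}"
    have wi: "w i \<in> carrier_vec n" using orthonormal_carrier[OF w(1) i] .
    define c where "c = (\<lambda>j. s j * (v j \<bullet> w i))"
    have "(transpose_mat (outer_sum m n N s u v) * outer_sum m n N s u v) *\<^sub>v w i
        = outer_sum n m N s v u *\<^sub>v (outer_sum m n N s u v *\<^sub>v w i)"
      using wi by (simp add: transpose_outer_sum assoc_mult_mat_vec[of _ n m _ n])
    also have "\<dots> = comb n N (\<lambda>j. s j * (u j \<bullet> comb m N c u)) v"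
      unfolding c_def
      by (subst outer_sum_mult_vec[OF wi vc], assumption, subst outer_sum_mult_vec[OF comb_carrier uc])
        auto
    also have "\<dots> = (if i \<le> N then (s i)\<^sup>2 else 0) \<cdot>\<^sub>v w i"
    proof (rule eq_vecI)
      fix l assume "l < dim_vec ((if i \<le> N then (s i)\<^sup>2 else 0) \<cdot>\<^sub>v w i)"
      then have l: "l < n" using wi by simp
      have "comb n N (\<lambda>j. s j * (u j \<bullet> comb m N c u)) v $ l
          = (\<Sum>j = 1..N. s j * (u j \<bullet> comb m N c u) * v j $ l)" using l by (simp add: comb_def)
      also have "\<dots> = (\<Sum>j = 1..N. if j = i then (s i)\<^sup>2 * w i $ l else 0)"
      proof (rule sum.cong[OF refl])
        fix j assume j: "j \<in> {1..N}"
        have "u j \<bullet> comb m N c u = c j" using scalar_prod_comb_orthonormal[OF u j le_refl] j by simp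
        moreover have "v j \<bullet> w i = (if j = i then 1 else 0)"
          using orthonormal_prod[OF w(1), of j i] w(2)[OF j] i j N by simp
        ultimately show "s j * (u j \<bullet> comb m N c u) * v j $ l = (if j = i then (s i)\<^sup>2 * w i $ l else 0)"
          using w(2)[OF j] by (auto simp: c_def power2_eq_square)
      qed
      also have "\<dots> = ((if i \<le> N then (s i)\<^sup>2 else 0) \<cdot>\<^sub>v w i) $ l"
        using i l wi by (simp add: sum.delta)
      finally show "comb n N (\<lambda>j. s j * (u j \<bullet> comb m N c u)) v $ l
          = ((if i \<le> N then (s i)\<^sup>2 else 0) \<cdot>\<^sub>v w i) $ l" .
    qed (use wi in \<open>simp add: comb_def\<close>)
    finally show "(transpose_mat (outer_sum m n N s u v) * outer_sum m n N s u v) *\<^sub>v w i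
        = (if i \<le> N then (s i)\<^sup>2 else 0) \<cdot>\<^sub>v w i" .
  qed (rule mult_carrier_mat[of _ n m], auto simp: transpose_outer_sum)
qed

lemma is_svd_eq_outer_sum:
  assumes "is_svd M u v" and "M \<in> carrier_mat m n"
  shows "M = outer_sum m n (min m n) (singular_value M) u v"
    and "orthonormal_upto m (min m n) u" and "orthonormal_upto n (min m n) v"
  using assms by (auto simp: is_svd_def svd_sum_eq_outer_sum)

text \<open>A decomposition refers to \<open>singular_value M\<close> itself, whose definition alone ensures neither
  nonnegativity nor order.  Both follow once the spectrum of the Gram matrix is computed from the
  decomposition.\<close>
lemma is_svd_spectrum:
  assumes "is_svd M u v" and "M \<in> carrier_mat m n"
  shows "proots (char_poly (transpose_mat M * M))
           = mset (map (\<lambda>i. if i \<le> min m n then (singular_value M i)\<^sup>2 else 0) [1..<Suc n])"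
  using proots_gram_outer_sum[OF is_svd_eq_outer_sum(2,3)[OF assms] min.cobounded2, of "singular_value M"]
  by (simp only: is_svd_eq_outer_sum(1)[OF assms, symmetric])

lemma is_svd_singular_value_nonneg:
  assumes "is_svd M u v" "M \<in> carrier_mat m n" "i \<in> {1..min m n}"
  shows "0 \<le> singular_value M i"
proof -
  have "i \<in> {1..n}" using assms(3) by auto
  from singular_value_in_spectrum[OF is_svd_spectrum[OF assms(1,2)] this] show ?thesis
    by (metis real_sqrt_ge_0_iff zero_le_power2 order_refl)
qed

lemma is_svd_singular_value_antimono:
  assumes "is_svd M u v" "M \<in> carrier_mat m n" "1 \<le> i" "i \<le> j" "j \<le> min m n"
  shows "singular_value M j \<le> singular_value M i"
  using singular_value_antimono[OF is_svd_spectrum[OF assms(1,2)]] assms(3-) by simp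

lemma schatten_norm_truncation:
  assumes tr: "is_svd_truncation r Z Zr" and Z: "Z \<in> carrier_mat m n" and r: "1 \<le> r" "r \<le> min m n"
  shows "schatten_norm \<infinity> Zr = singular_value Z 1"
    and "1 \<le> p \<Longrightarrow> schatten_norm (ereal p) Zr = (\<Sum>i = 1..r. singular_value Z i powr p) powr (1 / p)"
proof -
  obtain u v where svd: "is_svd Z u v" and Zr: "Zr = svd_sum Z u v r"
    using tr by (auto simp: is_svd_truncation_def)
  have Zr: "Zr = outer_sum m n r (singular_value Z) u v" using Zr Z by (simp add: svd_sum_eq_outer_sum)
  have uv: "orthonormal_upto m r u" "orthonormal_upto n r v"
    using is_svd_eq_outer_sum(2,3)[OF svd Z] r orthonormal_mono by blast+
  have rn: "r \<le> n" using r by simp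
  note nonneg = is_svd_singular_value_nonneg[OF svd Z]
  have sv: "singular_value Zr i = (if i \<le> r then singular_value Z i else 0)" if i: "i \<in> {1..n}" for i
  proof -
    have "singular_value Zr i = sqrt (if i \<le> r then (singular_value Z i)\<^sup>2 else 0)"
    proof (rule singular_value_eq[OF _ _ i])
      show "proots (char_poly (transpose_mat Zr * Zr))
          = mset (map (\<lambda>i. if i \<le> r then (singular_value Z i)\<^sup>2 else 0) [1..<Suc n])"
        unfolding Zr by (rule proots_gram_outer_sum[OF uv rn])
      show "(if j \<le> r then (singular_value Z j)\<^sup>2 else 0) \<le> (if i \<le> r then (singular_value Z i)\<^sup>2 else 0)"
        if "1 \<le> i" "i \<le> j" "j \<le> n" for i j
        using that r nonneg[of j] is_svd_singular_value_antimono[OF svd Z, of i j]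
        by (auto intro!: power_mono)
    qed
    then show ?thesis using nonneg[of i] i r by auto
  qed
  show "schatten_norm \<infinity> Zr = singular_value Z 1"
    using sv[of 1] r by (simp add: schatten_norm_def)
  show "schatten_norm (ereal p) Zr = (\<Sum>i = 1..r. singular_value Z i powr p) powr (1 / p)" if "1 \<le> p"
  proof -
    have "(\<Sum>i = 1..min m n. singular_value Zr i powr p) = (\<Sum>i = 1..r. singular_value Z i powr p)"
      using sv r by (intro sum.mono_neutral_cong_right) auto
    then show ?thesis using Zr by (simp add: schatten_norm_def outer_sum_def)
  qed
qed

lemma schatten_norm_mat_diag:
  shows "1 \<le> p \<Longrightarrow> schatten_norm (ereal p) (mat_diag r g) = (\<Sum>i = 1..r. \<bar>g (i - 1)\<bar> powr p) powr (1 / p)"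
    and "1 \<le> r \<Longrightarrow> \<exists>i\<in>{1..r}. schatten_norm \<infinity> (mat_diag r g) = \<bar>g (i - 1)\<bar>"
proof -
  define e where "e = (\<lambda>i. unit_vec r (i - 1) :: real vec)"
  define s where "s = (\<lambda>i. g (i - 1))"
  have e: "orthonormal_upto r r e"
    by (auto simp: orthonormal_upto_def e_def scalar_prod_left_unit)
  have diag: "mat_diag r g = outer_sum r r r s e e"
  proof (rule eq_matI)
    fix a b assume "a < dim_row (outer_sum r r r s e e)" "b < dim_col (outer_sum r r r s e e)"
    then have ab: "a < r" "b < r" by (auto simp: outer_sum_def)
    have "(\<Sum>i = 1..r. s i * (e i $ a) * (e i $ b)) = (\<Sum>i = 0..<r. if i = a then (if a = b then g b else 0) else 0)"
      unfolding sum_from_1_eq[of _ r, folded One_nat_def]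
      using ab by (intro sum.cong refl) (auto simp: s_def e_def)
    then show "mat_diag r g $$ (a, b) = outer_sum r r r s e e $$ (a, b)"
      using ab by (simp add: mat_diag_def outer_sum_def)
  qed (auto simp: mat_diag_def outer_sum_def)
  have spec: "proots (char_poly (transpose_mat (mat_diag r g) * mat_diag r g))
      = mset (map (\<lambda>i. if i \<le> r then (s i)\<^sup>2 else 0) [1..<Suc r])"
    unfolding diag by (rule proots_gram_outer_sum[OF e e le_refl])
  show "schatten_norm (ereal p) (mat_diag r g) = (\<Sum>i = 1..r. \<bar>g (i - 1)\<bar> powr p) powr (1 / p)"
    using sum_singular_values[OF spec, of "\<lambda>x. x powr p"]
    by (simp add: schatten_norm_def mat_diag_def s_def)
  show "\<exists>i\<in>{1..r}. schatten_norm \<infinity> (mat_diag r g) = \<bar>g (i - 1)\<bar>" if "1 \<le> r"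
  proof -
    have "1 \<in> {1..r}" using that by simp
    then obtain k where k: "k \<in> {1..r}"
      "singular_value (mat_diag r g) 1 = sqrt (if k \<le> r then (s k)\<^sup>2 else 0)"
      using singular_value_in_spectrum[OF spec] by blast
    then have "schatten_norm \<infinity> (mat_diag r g) = \<bar>g (k - 1)\<bar>"
      by (simp add: schatten_norm_def s_def)
    then show ?thesis using k(1) by blast
  qed
qed

section \<open>Principal angles through an eigenbasis\<close>

text \<open>Let \<open>w\<close> be an orthonormal eigenbasis of \<open>G\<^sup>T G\<close> for \<open>G = Uh\<^sup>T U\<close>, with eigenvalues \<open>c\<close>.  The vectors
  \<open>U w i\<close>, which \<open>comb\<close> expresses here, have projections onto the column space of \<open>Uh\<close> that are mutually
  orthogonal with squared norms \<open>c i\<close>, and the sines of the principal angles are \<open>sqrt (1 - c i)\<close>.\<close>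
lemma sin_Theta_dist_spectrum:
  fixes u uh :: "nat \<Rightarrow> real vec"
  assumes u: "orthonormal_upto m r u" and uh: "orthonormal_upto m r uh"
  defines "U \<equiv> mat_of_cols m (map u [1..<Suc r])" and "Uh \<equiv> mat_of_cols m (map uh [1..<Suc r])"
  obtains w c where "orthonormal_upto r r w"
    and "\<And>i k. i \<in> {1..r} \<Longrightarrow> k \<in> {1..r} \<Longrightarrow>
        (\<Sum>j = 1..r. (uh j \<bullet> comb m r (\<lambda>l. w i $ (l - 1)) u) * (uh j \<bullet> comb m r (\<lambda>l. w k $ (l - 1)) u))
          = (if i = k then c i else 0)"
    and "\<And>p. 1 \<le> p \<Longrightarrow> sin_Theta_dist (ereal p) Uh U = (\<Sum>i = 1..r. sqrt (1 - c i) powr p) powr (1 / p)"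
    and "1 \<le> r \<Longrightarrow> \<exists>i\<in>{1..r}. sin_Theta_dist \<infinity> Uh U = sqrt (1 - c i)"
proof -
  define G where "G = transpose_mat Uh * U"
  note uc = orthonormal_carrier[OF u] and uhc = orthonormal_carrier[OF uh]
  have U: "U \<in> carrier_mat m r" "\<And>j. j < r \<Longrightarrow> col U j = u (Suc j)"
    unfolding U_def using mat_of_cols_upt[of r u m] uc by auto
  have Uh: "Uh \<in> carrier_mat m r" "\<And>j. j < r \<Longrightarrow> col Uh j = uh (Suc j)"
    unfolding Uh_def using mat_of_cols_upt[of r uh m] uhc by auto
  have G: "G \<in> carrier_mat r r" using U Uh by (simp add: G_def)
  have GG: "transpose_mat G * G \<in> carrier_mat r r" using G by simp
  have "transpose_mat (transpose_mat G * G) = transpose_mat G * G"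
    using transpose_mult[OF transpose_carrier_mat[THEN iffD2, OF G] G] by (simp only: transpose_transpose)
  then obtain w c where w: "orthonormal_upto r r w"
    and eig: "\<And>i. i \<in> {1..r} \<Longrightarrow> (transpose_mat G * G) *\<^sub>v w i = c i \<cdot>\<^sub>v w i"
    using symmetric_orthonormal_eigenbasis[OF GG] by blast
  note wc = orthonormal_carrier[OF w]
  define z where "z = (\<lambda>i. comb m r (\<lambda>l. w i $ (l - 1)) u)"
  have z: "z i \<in> carrier_vec m" for i by (simp add: z_def)
  have Gw: "(G *\<^sub>v w i) $ j = uh (Suc j) \<bullet> z i" if "j < r" "i \<in> {1..r}" for i j
  proof -
    have "uh (Suc j) \<bullet> z i = (\<Sum>l = 1..r. w i $ (l - 1) * (uh (Suc j) \<bullet> u l))"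
      unfolding z_def by (rule scalar_prod_comb_right[OF uc])
    also have "\<dots> = (\<Sum>l = 0..<r. G $$ (j, l) * w i $ l)"
      using that(1) U Uh by (simp add: sum_from_1_eq G_def mult.commute)
    also have "\<dots> = (G *\<^sub>v w i) $ j" using G wc[OF that(2)] that(1) by (simp add: scalar_prod_def)
    finally show ?thesis by simp
  qed
  have gram: "(\<Sum>j = 1..r. (uh j \<bullet> z i) * (uh j \<bullet> z k)) = (if i = k then c i else 0)"
    if i: "i \<in> {1..r}" and k: "k \<in> {1..r}" for i k
  proof -
    have "(\<Sum>j = 1..r. (uh j \<bullet> z i) * (uh j \<bullet> z k)) = (G *\<^sub>v w i) \<bullet> (G *\<^sub>v w k)"
      using G Gw[OF _ i] Gw[OF _ k] by (simp add: sum_from_1_eq scalar_prod_def)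
    also have "\<dots> = (transpose_mat G *\<^sub>v (G *\<^sub>v w i)) \<bullet> w k"
      using G wc[OF i] wc[OF k] by (intro transpose_vec_mult_scalar[symmetric]) auto
    also have "transpose_mat G *\<^sub>v (G *\<^sub>v w i) = c i \<cdot>\<^sub>v w i"
      using eig[OF i] G wc[OF i] by (simp add: assoc_mult_mat_vec[of _ r r _ r])
    also have "(c i \<cdot>\<^sub>v w i) \<bullet> w k = (if i = k then c i else 0)"
      using wc[OF i] wc[OF k] orthonormal_prod[OF w i k] by simp
    finally show ?thesis .
  qed
  have c: "0 \<le> c i" "c i \<le> 1" if i: "i \<in> {1..r}" for i
  proof -
    have *: "c i = (\<Sum>j = 1..r. (uh j \<bullet> z i)\<^sup>2)" using gram[OF i i] by (simp add: power2_eq_square)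
    then show "0 \<le> c i" by (simp add: sum_nonneg)
    have "c i \<le> z i \<bullet> z i" using besselD(2)[OF bessel_if_orthonormal[OF uh] z] * by simp
    also have "\<dots> = (\<Sum>l = 1..r. w i $ (l - 1) * w i $ (l - 1))"
      unfolding z_def by (rule comb_orthonormal_prod[OF u])
    also have "\<dots> = w i \<bullet> w i" using wc[OF i] by (simp add: sum_from_1_eq scalar_prod_def)
    also have "\<dots> = 1" using orthonormal_prod[OF w i i] by simp
    finally show "c i \<le> 1" .
  qed
  have spec: "proots (char_poly (transpose_mat G * G)) = mset (map c [1..<Suc r])"
    by (rule proots_char_poly_orthonormal_eigenbasis[OF GG w eig])
  have angle: "\<bar>sin (arccos (sqrt (c i)))\<bar> = sqrt (1 - c i)" if "i \<in> {1..r}" for i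
  proof -
    have "-1 \<le> sqrt (c i)" using c[OF that] by (meson order_trans neg_le_0_iff_le real_sqrt_ge_zero zero_le_one)
    then show ?thesis using c[OF that] by (simp add: sin_arccos)
  qed
  have dim: "dim_col Uh = r" using Uh by simp
  show thesis
  proof (rule that[OF w gram[unfolded z_def]])
    show "sin_Theta_dist (ereal p) Uh U = (\<Sum>i = 1..r. sqrt (1 - c i) powr p) powr (1 / p)" if "1 \<le> p" for p
    proof -
      have "sin_Theta_dist (ereal p) Uh U
          = (\<Sum>i = 1..r. \<bar>sin (principal_angle Uh U (Suc (i - 1)))\<bar> powr p) powr (1 / p)"
        unfolding sin_Theta_dist_def sin_Theta_def dim using that by (rule schatten_norm_mat_diag(1))
      also have "(\<Sum>i = 1..r. \<bar>sin (principal_angle Uh U (Suc (i - 1)))\<bar> powr p)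
          = (\<Sum>i = 1..r. \<bar>sin (arccos (singular_value G i))\<bar> powr p)"
        by (intro sum.cong) (auto simp: principal_angle_def G_def)
      also have "\<dots> = (\<Sum>i = 1..r. \<bar>sin (arccos (sqrt (c i)))\<bar> powr p)"
        by (rule sum_singular_values[OF spec])
      also have "\<dots> = (\<Sum>i = 1..r. sqrt (1 - c i) powr p)"
        using angle by (intro sum.cong refl) simp
      finally show ?thesis .
    qed
    show "\<exists>i\<in>{1..r}. sin_Theta_dist \<infinity> Uh U = sqrt (1 - c i)" if r: "1 \<le> r"
    proof -
      obtain i where i: "i \<in> {1..r}"
        "sin_Theta_dist \<infinity> Uh U = \<bar>sin (principal_angle Uh U (Suc (i - 1)))\<bar>"
        using schatten_norm_mat_diag(2)[OF r] unfolding sin_Theta_dist_def sin_Theta_def dim by blast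
      obtain k where "k \<in> {1..r}" "singular_value G i = sqrt (c k)"
        using singular_value_in_spectrum[OF spec i(1)] .
      then show ?thesis using i angle by (auto simp: principal_angle_def G_def)
    qed
  qed
qed

section \<open>Rank and vanishing singular values\<close>

lemma rank_outer_sum_le: "vec_space.rank m (outer_sum m n k s u v) \<le> k"
proof (induction k)
  case 0
  have "outer_sum m n 0 s u v = 0\<^sub>m m n" by (rule eq_matI) (auto simp: outer_sum_def)
  then show ?case using vec_space.rank_0I[of m n, where ?'a = real] by simp
next
  case (Suc k)
  define E where "E = mat m n (\<lambda>(a, b). (s (Suc k) * u (Suc k) $ a) * v (Suc k) $ b)"
  have E: "E \<in> carrier_mat m n" by (simp add: E_def)
  have "outer_sum m n (Suc k) s u v = outer_sum m n k s u v + E"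
    by (rule eq_matI) (auto simp: outer_sum_def E_def)
  then have "vec_space.rank m (outer_sum m n (Suc k) s u v)
      \<le> vec_space.rank m (outer_sum m n k s u v) + vec_space.rank m E"
    using vec_space.rank_subadditive[OF outer_sum_carrier E] by simp
  moreover have "vec_space.rank m E \<le> 1"
    by (rule vec_space.rank_le_1_product_entries[OF E, of "\<lambda>a. s (Suc k) * u (Suc k) $ a" "\<lambda>b. v (Suc k) $ b"])
      (simp add: E_def)
  ultimately show ?case using Suc.IH by linarith
qed

text \<open>An orthonormal family in the column space is linearly independent, so it has at most \<open>rank A\<close>
  members.\<close>
lemma orthonormal_card_le_rank:
  assumes A: "A \<in> carrier_mat m n" and u: "orthonormal_upto m k u"
    and range: "\<And>i. i \<in> {1..k} \<Longrightarrow> \<exists>y\<in>carrier_vec n. A *\<^sub>v y = u i"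
  shows "k \<le> vec_space.rank m A"
proof -
  interpret vec_space "TYPE(real)" m .
  note uc = orthonormal_carrier[OF u]
  define Q where "Q = mat_of_cols m (map u [1..<Suc k])"
  have Q: "Q \<in> carrier_mat m k"
    unfolding Q_def using mat_of_cols_upt(1)[of k u m] uc by auto
  have QQ: "transpose_mat Q * Q = 1\<^sub>m k"
    unfolding Q_def by (rule orthonormal_transpose_mult[OF u])
  have cols: "cols Q = map u [1..<Suc k]"
    unfolding Q_def by (rule cols_mat_of_cols) (use uc in auto)
  have "inj_on u {1..k}"
  proof (rule inj_onI)
    fix i j assume "i \<in> {1..k}" "j \<in> {1..k}" "u i = u j"
    then show "i = j"
      using orthonormal_prod[OF u, of i j] orthonormal_prod[OF u, of j j] by (auto split: if_splits)
  qed
  then have dist: "distinct (cols Q)"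
    by (simp only: cols distinct_map distinct_upt set_upt atLeastLessThanSuc_atLeastAtMost simp_thms)
  have indpt: "lin_indpt (set (cols Q))"
  proof
    assume "lin_dep (set (cols Q))"
    then obtain x where x: "x \<in> carrier_vec k" "x \<noteq> 0\<^sub>v k" "Q *\<^sub>v x = 0\<^sub>v m"
      using lin_depE[OF Q _ dist] by blast
    have "x = (transpose_mat Q * Q) *\<^sub>v x" using QQ x(1) by simp
    also have "\<dots> = transpose_mat Q *\<^sub>v (Q *\<^sub>v x)"
      by (rule assoc_mult_mat_vec[OF _ Q x(1)]) (use Q in simp)
    also have "\<dots> = 0\<^sub>v k" using Q x(3) by (intro eq_vecI) auto
    finally show False using x(2) by simp
  qed
  have colsA: "set (cols A) \<subseteq> carrier_vec m" using A cols_dim by blast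
  have sub: "set (cols Q) \<subseteq> span (set (cols A))"
  proof
    fix a assume "a \<in> set (cols Q)"
    then have "a \<in> u ` {1..k}"
      by (simp only: cols set_map set_upt atLeastLessThanSuc_atLeastAtMost)
    then obtain i where i: "i \<in> {1..k}" "a = u i" by blast
    then show "a \<in> span (set (cols A))"
      using range[OF i(1)] col_space_eq[OF A] A uc[OF i(1)] by (auto simp: col_space_def)
  qed
  have submod: "submodule class_ring (span (set (cols A))) V"
    using colsA by (intro span_is_submodule) simp
  have vs: "vectorspace class_ring (span_vs (set (cols A)))"
    using colsA by (intro subspace_is_vs span_is_subspace) simp
  have "card (set (cols Q)) \<le> vectorspace.dim class_ring (span_vs (set (cols A)))"
  proof (rule vectorspace.li_le_dim(2)[OF vs fin_dim_span_cols[OF A]])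
    show "set (cols Q) \<subseteq> carrier (span_vs (set (cols A)))" using sub by simp
    show "\<not> LinearCombinations.module.lin_dep class_ring (span_vs (set (cols A))) (set (cols Q))"
      using span_li_not_depend(2)[OF sub submod] indpt by simp
  qed
  moreover have "card (set (cols Q)) = k" using distinct_card[OF dist] Q by simp
  ultimately show ?thesis by (simp add: rank_def)
qed

lemma is_svd_rank:
  assumes svd: "is_svd A u v" and A: "A \<in> carrier_mat m n"
    and rank: "vec_space.rank m A = r" and r: "1 \<le> r" "r \<le> min m n"
  shows "0 < singular_value A r" and "\<And>j. r < j \<Longrightarrow> j \<le> min m n \<Longrightarrow> singular_value A j = 0"
proof -
  define N where "N = min m n"
  define s where "s = singular_value A"
  note AN = is_svd_eq_outer_sum[OF svd A, folded N_def s_def]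
  note nonneg = is_svd_singular_value_nonneg[OF svd A, folded N_def s_def]
  note dec = is_svd_singular_value_antimono[OF svd A, folded N_def s_def]
  show "0 < singular_value A r"
  proof (rule ccontr)
    assume "\<not> 0 < singular_value A r"
    then have sr: "s r = 0" using nonneg[of r] r by (simp add: s_def N_def)
    have "s j = 0" if "j \<in> {r..N}" for j
      using that dec[of r j] nonneg[of j] r sr by auto
    then have "(\<Sum>i = 1..N. s i * u i $ a * v i $ b) = (\<Sum>i = 1..r - 1. s i * u i $ a * v i $ b)" for a b
      using r by (intro sum.mono_neutral_right) (auto simp: N_def)
    then have "A = outer_sum m n (r - 1) s u v" by (subst AN(1)) (simp add: outer_sum_def)
    then have "vec_space.rank m A \<le> r - 1" by (metis rank_outer_sum_le)
    then show False using rank r by simp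
  qed
  have "s (Suc r) \<le> 0" if "Suc r \<le> N"
  proof (rule ccontr)
    assume "\<not> s (Suc r) \<le> 0"
    then have pos: "0 < s i" if "i \<in> {1..Suc r}" for i
      using that dec[of i "Suc r"] \<open>Suc r \<le> N\<close> by auto
    have "Suc r \<le> vec_space.rank m A"
    proof (rule orthonormal_card_le_rank[OF A orthonormal_mono[OF AN(2) that]])
      fix i assume i: "i \<in> {1..Suc r}"
      then have iN: "i \<in> {1..N}" using that by auto
      note uc = orthonormal_carrier[OF AN(2)] and vc = orthonormal_carrier[OF AN(3)]
      define y where "y = (1 / s i) \<cdot>\<^sub>v v i"
      have y: "y \<in> carrier_vec n" using vc[OF iN] by (simp add: y_def)
      have "A *\<^sub>v y = comb m N (\<lambda>j. s j * (v j \<bullet> y)) u"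
        by (subst AN(1), subst outer_sum_mult_vec[OF y vc], assumption, rule refl)
      also have "\<dots> = u i"
      proof (rule eq_vecI)
        fix l assume "l < dim_vec (u i)"
        then have l: "l < m" using uc[OF iN] by simp
        have "(\<Sum>j = 1..N. s j * (v j \<bullet> y) * u j $ l) = (\<Sum>j = 1..N. if j = i then u i $ l else 0)"
        proof (rule sum.cong[OF refl])
          fix j assume j: "j \<in> {1..N}"
          have "v j \<bullet> y = (1 / s i) * (v j \<bullet> v i)"
            unfolding y_def using vc[OF j] vc[OF iN] by simp
          then show "s j * (v j \<bullet> y) * u j $ l = (if j = i then u i $ l else 0)"
            using orthonormal_prod[OF AN(3) j iN] pos[OF i] by simp
        qed
        then show "comb m N (\<lambda>j. s j * (v j \<bullet> y)) u $ l = u i $ l"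
          using l iN by (simp add: comb_def sum.delta)
      qed (use uc[OF iN] in \<open>simp add: comb_def\<close>)
      finally show "\<exists>y\<in>carrier_vec n. A *\<^sub>v y = u i" using y by blast
    qed
    then show False using rank by simp
  qed
  then show "singular_value A j = 0" if "r < j" "j \<le> min m n" for j
    using that dec[of "Suc r" j] nonneg[of j] by (force simp: s_def N_def)
qed

section \<open>The perturbation argument\<close>

text \<open>Singular value decompositions of \<open>A\<close> (rank \<open>r\<close>, values \<open>s\<close>), of \<open>B = A + Z\<close> (values \<open>t\<close>) and of \<open>Z\<close> (values
  \<open>z\<close>), where the equation \<open>B = A + Z\<close> is expressed by the bilinear forms \<open>x\<^sup>T B y = x\<^sup>T A y + x\<^sup>T Z y\<close>.  The
  assumptions are symmetric under exchanging left and right singular vectors, so that statements on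
  the left subspaces also cover the right ones.\<close>
locale low_rank_perturbation =
  fixes m n N r :: nat and s t z :: "nat \<Rightarrow> real" and u v uh vh a b :: "nat \<Rightarrow> real vec"
  assumes r: "1 \<le> r" "r \<le> N"
    and u: "orthonormal_upto m r u" and v: "orthonormal_upto n r v"
    and uh: "orthonormal_upto m N uh" and vh: "orthonormal_upto n N vh"
    and a: "orthonormal_upto m N a" and b: "orthonormal_upto n N b"
    and s_pos: "0 < s r" and s_ge: "\<And>j. j \<in> {1..r} \<Longrightarrow> s r \<le> s j"
    and t_nonneg: "\<And>j. j \<in> {1..N} \<Longrightarrow> 0 \<le> t j"
    and t_dec: "\<And>i j. 1 \<le> i \<Longrightarrow> i \<le> j \<Longrightarrow> j \<le> N \<Longrightarrow> t j \<le> t i"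
    and z_nonneg: "\<And>j. j \<in> {1..N} \<Longrightarrow> 0 \<le> z j"
    and z_dec: "\<And>i j. 1 \<le> i \<Longrightarrow> i \<le> j \<Longrightarrow> j \<le> N \<Longrightarrow> z j \<le> z i"
    and forms: "\<And>x y. x \<in> carrier_vec m \<Longrightarrow> y \<in> carrier_vec n \<Longrightarrow>
      (\<Sum>j = 1..N. t j * (x \<bullet> uh j) * (vh j \<bullet> y))
        = (\<Sum>j = 1..r. s j * (x \<bullet> u j) * (v j \<bullet> y)) + (\<Sum>j = 1..N. z j * (x \<bullet> a j) * (b j \<bullet> y))"
begin

text \<open>Weyl's inequality.  By counting dimensions there is a nonzero vector \<open>y\<close> in the span of
  \<open>vh 1, ..., vh (r + j)\<close> that is orthogonal to \<open>v 1, ..., v r\<close> and to \<open>b 1, ..., b (j - 1)\<close>.  For the vector \<open>x\<close>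
  with the same coefficients in \<open>uh\<close>, the form of \<open>B\<close> at \<open>(x, y)\<close> is at least \<open>t (r + j) (y \<bullet> y)\<close>, the form of \<open>A\<close>
  vanishes, and the form of \<open>Z\<close> is at most \<open>z j (y \<bullet> y)\<close>.\<close>
lemma weyl:
  assumes j: "1 \<le> j" "r + j \<le> N"
  shows "t (r + j) \<le> z j"
proof -
  define K where "K = r + j"
  have K: "K \<le> N" using j by (simp add: K_def)
  define f where "f = (\<lambda>k l. if k \<le> r then v k \<bullet> vh l else b (k - r) \<bullet> vh l)"
  have "r + (j - 1) < K" using j by (simp add: K_def)
  then obtain c where c0: "\<exists>l\<in>{1..K}. c l \<noteq> 0"
    and c: "\<And>k. k \<in> {1..r + (j - 1)} \<Longrightarrow> (\<Sum>l = 1..K. c l * f k l) = 0"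
    using homogeneous_system_nontrivial[of "r + (j - 1)" K f] by blast
  define C where "C = (\<Sum>l = 1..K. c l * c l)"
  have C: "0 < C"
  proof -
    obtain l where "l \<in> {1..K}" "c l \<noteq> 0" using c0 by blast
    then have "0 < c l * c l" "c l * c l \<le> C"
      unfolding C_def by (auto simp: zero_less_mult_iff intro!: member_le_sum[of _ _ "\<lambda>l. c l * c l"])
    then show ?thesis by linarith
  qed
  define x where "x = comb m K c uh"
  define y where "y = comb n K c vh"
  have xy: "x \<in> carrier_vec m" "y \<in> carrier_vec n" by (simp_all add: x_def y_def)
  have uhK: "orthonormal_upto m K uh" and vhK: "orthonormal_upto n K vh"
    using uh vh K by (auto intro: orthonormal_mono)
  have xx: "x \<bullet> x = C" and yy: "y \<bullet> y = C"
    unfolding x_def y_def C_def by (rule comb_orthonormal_prod[OF uhK] comb_orthonormal_prod[OF vhK])+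
  have prod_y: "e \<bullet> y = (\<Sum>l = 1..K. c l * (e \<bullet> vh l))" for e
    unfolding y_def by (rule scalar_prod_comb_right[OF orthonormal_carrier[OF vhK]])
  have vy: "v k \<bullet> y = 0" if "k \<in> {1..r}" for k
    using c[of k] that by (simp add: prod_y f_def)
  have b_y: "b k \<bullet> y = 0" if "k \<in> {1..j - 1}" for k
    using c[of "r + k"] that by (simp add: prod_y f_def)
  have "t K * C = (\<Sum>l = 1..K. t K * (c l * c l))" by (simp add: C_def sum_distrib_left)
  also have "\<dots> \<le> (\<Sum>l = 1..K. t l * (c l * c l))"
    using K by (intro sum_mono mult_right_mono t_dec) auto
  also have "\<dots> = (\<Sum>l = 1..N. t l * (x \<bullet> uh l) * (vh l \<bullet> y))"
  proof (rule sum.mono_neutral_cong_left)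
    have vhy: "vh l \<bullet> y = (if l \<le> K then c l else 0)" if "l \<in> {1..N}" for l
      unfolding y_def by (rule scalar_prod_comb_orthonormal[OF vh that K])
    have uhx: "x \<bullet> uh l = (if l \<le> K then c l else 0)" if "l \<in> {1..N}" for l
      using scalar_prod_comb_orthonormal[OF uh that K, of c]
        comm_scalar_prod[OF xy(1) orthonormal_carrier[OF uh that]] by (simp add: x_def)
    show "\<forall>l\<in>{1..N} - {1..K}. t l * (x \<bullet> uh l) * (vh l \<bullet> y) = 0"
      using vhy by auto
    show "t l * (c l * c l) = t l * (x \<bullet> uh l) * (vh l \<bullet> y)" if "l \<in> {1..K}" for l
      using that K vhy[of l] uhx[of l] by auto
  qed (use K in auto)
  also have "\<dots> = (\<Sum>l = 1..N. z l * (x \<bullet> a l) * (b l \<bullet> y))"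
    unfolding forms[OF xy] using vy by simp
  also have "\<dots> \<le> (\<Sum>l = 1..N. z j * (((x \<bullet> a l)\<^sup>2 + (b l \<bullet> y)\<^sup>2) / 2))"
  proof (rule sum_mono)
    fix l assume l: "l \<in> {1..N}"
    have zj: "0 \<le> z j" using j by (intro z_nonneg) auto
    show "z l * (x \<bullet> a l) * (b l \<bullet> y) \<le> z j * (((x \<bullet> a l)\<^sup>2 + (b l \<bullet> y)\<^sup>2) / 2)"
    proof (cases "l < j")
      case True
      then show ?thesis using b_y[of l] l zj by simp
    next
      case False
      have "0 \<le> (x \<bullet> a l - b l \<bullet> y)\<^sup>2" by simp
      then have "(x \<bullet> a l) * (b l \<bullet> y) \<le> ((x \<bullet> a l)\<^sup>2 + (b l \<bullet> y)\<^sup>2) / 2"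
        by (simp add: power2_diff)
      then have "z l * ((x \<bullet> a l) * (b l \<bullet> y)) \<le> z l * (((x \<bullet> a l)\<^sup>2 + (b l \<bullet> y)\<^sup>2) / 2)"
        using z_nonneg[OF l] by (rule mult_left_mono)
      also have "\<dots> \<le> z j * (((x \<bullet> a l)\<^sup>2 + (b l \<bullet> y)\<^sup>2) / 2)"
        using False l j by (intro mult_right_mono z_dec) auto
      finally show ?thesis by (simp add: mult.assoc)
    qed
  qed
  also have "\<dots> = z j * (((\<Sum>l = 1..N. (x \<bullet> a l)\<^sup>2) + (\<Sum>l = 1..N. (b l \<bullet> y)\<^sup>2)) / 2)"
    by (simp add: sum_distrib_left[symmetric] sum.distrib sum_divide_distrib[symmetric])
  also have "\<dots> \<le> z j * ((C + C) / 2)"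
    using besselD(3)[OF bessel_if_orthonormal[OF a] xy(1)] besselD(2)[OF bessel_if_orthonormal[OF b] xy(2)]
      xx yy j by (intro mult_left_mono z_nonneg) auto
  finally show ?thesis using C by (simp add: K_def)
qed

text \<open>The bilinear form of \<open>P B - Z\<close>, where \<open>P\<close> projects onto the orthogonal complement of \<open>uh 1, ..., uh r\<close>:
  only the terms of \<open>B\<close> beyond the \<open>r\<close>-th survive.  It agrees with the form of \<open>A\<close> whenever \<open>P x = x\<close>.\<close>
definition residual :: "real vec \<Rightarrow> real vec \<Rightarrow> real" where
  "residual x y = (\<Sum>j = 1..N - r. t (r + j) * (x \<bullet> uh (r + j)) * (vh (r + j) \<bullet> y))
     - (\<Sum>j = 1..N. z j * (x \<bullet> a j) * (b j \<bullet> y))"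

text \<open>The singular values of \<open>P B\<close> are \<open>t (r + 1), t (r + 2), ...\<close>, which Weyl's inequality bounds by
  \<open>z 1, z 2, ...\<close>; hence both parts of the residual obey the same variational bound, and their
  difference gets the factor 2.\<close>
lemma residual_powr_le:
  assumes x: "bessel m k x" and y: "bessel n k y" and k: "1 \<le> k" "k \<le> N" and p: "1 \<le> p"
  shows "(\<Sum>i = 1..k. \<bar>residual (x i) (y i)\<bar> powr p) \<le> 2 powr p * (\<Sum>j = 1..k. z j powr p)"
proof -
  define S where "S = (\<Sum>j = 1..k. z j powr p)"
  define f where "f = (\<lambda>i. \<Sum>j = 1..N - r. t (r + j) * (x i \<bullet> uh (r + j)) * (vh (r + j) \<bullet> y i))"
  define g where "g = (\<lambda>i. \<Sum>j = 1..N. z j * (x i \<bullet> a j) * (b j \<bullet> y i))"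
  have tail: "orthonormal_upto m (N - r) (\<lambda>j. uh (r + j))" "orthonormal_upto n (N - r) (\<lambda>j. vh (r + j))"
    using uh vh by (auto simp: orthonormal_upto_def)
  have "(\<Sum>i = 1..k. \<bar>f i\<bar> powr p) \<le> (\<Sum>j = 1..min k (N - r). t (r + j) powr p)"
    unfolding f_def
    using tail[THEN bessel_if_orthonormal] x y k p r t_nonneg t_dec
    by (intro bessel_pairing_powr_le[of m _ _ n]) auto
  also have "\<dots> \<le> (\<Sum>j = 1..min k (N - r). z j powr p)"
    using p r by (intro sum_mono powr_mono2 weyl t_nonneg) auto
  also have "\<dots> \<le> S"
    unfolding S_def by (intro sum_mono2) auto
  finally have f: "(\<Sum>i = 1..k. \<bar>f i\<bar> powr p) \<le> S" .
  have "(\<Sum>i = 1..k. \<bar>g i\<bar> powr p) \<le> (\<Sum>j = 1..min k N. z j powr p)"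
    unfolding g_def using a[THEN bessel_if_orthonormal] b[THEN bessel_if_orthonormal] x y k p z_nonneg z_dec
    by (intro bessel_pairing_powr_le[of m _ _ n]) auto
  then have g: "(\<Sum>i = 1..k. \<bar>g i\<bar> powr p) \<le> S" using k by (simp add: S_def min_def)
  have "(\<Sum>i = 1..k. \<bar>residual (x i) (y i)\<bar> powr p) = (\<Sum>i = 1..k. \<bar>f i + - g i\<bar> powr p)"
    by (simp add: residual_def f_def g_def)
  also have "\<dots> \<le> (\<Sum>i = 1..k. 2 powr p * ((\<bar>f i\<bar> powr p + \<bar>- g i\<bar> powr p) / 2))"
    using p by (intro sum_mono abs_add_powr_le)
  also have "\<dots> = 2 powr p * (((\<Sum>i = 1..k. \<bar>f i\<bar> powr p) + (\<Sum>i = 1..k. \<bar>g i\<bar> powr p)) / 2)"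
    by (simp add: sum_distrib_left[symmetric] sum.distrib sum_divide_distrib[symmetric])
  also have "\<dots> \<le> 2 powr p * ((S + S) / 2)" using f g by (intro mult_left_mono) auto
  finally show ?thesis by (simp add: S_def)
qed

text \<open>With \<open>f i = U w i\<close> and its component \<open>e i = P (f i)\<close> orthogonal to \<open>uh 1, ..., uh r\<close>, the vectors \<open>e i\<close> are
  mutually orthogonal of norm \<open>sqrt (1 - c i)\<close>.  Take \<open>x i\<close> as \<open>e i\<close> normalised, and \<open>y i = V C (w i)\<close> for the
  contraction \<open>C = diag (s r / s j)\<close>, so that \<open>A (y i) = s r (f i)\<close> and the form of \<open>A\<close> at \<open>(x i, y i)\<close> equals
  \<open>s r sqrt (1 - c i)\<close>.  The family \<open>y\<close> is Bessel but need not be orthonormal.\<close>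
lemma sines_eq_residual:
  assumes w: "orthonormal_upto r r w"
    and gram: "\<And>i k. i \<in> {1..r} \<Longrightarrow> k \<in> {1..r} \<Longrightarrow>
        (\<Sum>j = 1..r. (uh j \<bullet> comb m r (\<lambda>l. w i $ (l - 1)) u) * (uh j \<bullet> comb m r (\<lambda>l. w k $ (l - 1)) u))
          = (if i = k then c i else 0)"
  obtains x y where "bessel m r x" "bessel n r y"
    and "\<And>i. i \<in> {1..r} \<Longrightarrow> s r * sqrt (1 - c i) = residual (x i) (y i)"
    and "\<And>i. i \<in> {1..r} \<Longrightarrow> c i \<le> 1"
proof -
  note uc = orthonormal_carrier[OF u] and vc = orthonormal_carrier[OF v] and wc = orthonormal_carrier[OF w]
  have uhr: "orthonormal_upto m r uh" using uh r(2) by (rule orthonormal_mono)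
  note uhc = orthonormal_carrier[OF uhr]
  define f where "f = (\<lambda>i. comb m r (\<lambda>l. w i $ (l - 1)) u)"
  have f: "f i \<in> carrier_vec m" for i by (simp add: f_def)
  have ff: "f i \<bullet> f k = (if i = k then 1 else 0)" if i: "i \<in> {1..r}" and k: "k \<in> {1..r}" for i k
  proof -
    have "f i \<bullet> f k = (\<Sum>l = 1..r. w i $ (l - 1) * w k $ (l - 1))"
      unfolding f_def by (rule comb_orthonormal_prod[OF u])
    also have "\<dots> = w i \<bullet> w k" using wc[OF k] by (simp add: sum_from_1_eq scalar_prod_def)
    finally show ?thesis using orthonormal_prod[OF w i k] by simp
  qed
  define g where "g = (\<lambda>i. comb m r (\<lambda>j. uh j \<bullet> f i) uh)"
  have g: "g i \<in> carrier_vec m" for i by (simp add: g_def)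
  define e where "e = (\<lambda>i. f i - g i)"
  have e: "e i \<in> carrier_vec m" for i using f g by (simp add: e_def)
  have uhe: "uh j \<bullet> e i = 0" if j: "j \<in> {1..r}" for i j
    unfolding e_def using scalar_prod_minus_distrib[OF uhc[OF j] f g]
      scalar_prod_comb_orthonormal[OF uhr j le_refl] j by (simp add: g_def)
  have ef: "e i \<bullet> f k = (if i = k then 1 - c i else 0)" if i: "i \<in> {1..r}" and k: "k \<in> {1..r}" for i k
  proof -
    have "g i \<bullet> f k = (\<Sum>j = 1..r. (uh j \<bullet> f i) * (uh j \<bullet> f k))"
      unfolding g_def by (rule scalar_prod_comb_left[OF uhc f])
    also have "\<dots> = (if i = k then c i else 0)" using gram[OF i k] by (simp add: f_def)
    finally show ?thesis unfolding e_def using minus_scalar_prod_distrib[OF f g f] ff[OF i k] by simp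
  qed
  have ee: "e i \<bullet> e k = (if i = k then 1 - c i else 0)" if i: "i \<in> {1..r}" and k: "k \<in> {1..r}" for i k
  proof -
    have "e i \<bullet> g k = (\<Sum>j = 1..r. (uh j \<bullet> f k) * (e i \<bullet> uh j))"
      unfolding g_def by (rule scalar_prod_comb_right[OF uhc])
    also have "\<dots> = 0"
    proof (rule sum.neutral, rule ballI)
      fix j assume j: "j \<in> {1..r}"
      show "(uh j \<bullet> f k) * (e i \<bullet> uh j) = 0"
        using uhe[OF j, of i] comm_scalar_prod[OF e uhc[OF j]] by simp
    qed
    finally show ?thesis using scalar_prod_minus_distrib[OF e f g, of i k k] ef[OF i k] by (simp add: e_def)
  qed
  have c: "c i \<le> 1" if i: "i \<in> {1..r}" for i
    using scalar_prod_self_nonneg[of "e i"] ee[OF i i] by simp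
  \<comment> \<open>If \<open>c i = 1\<close> then \<open>e i = 0\<close>, and division by zero makes \<open>x i\<close> the zero vector.\<close>
  define x where "x = (\<lambda>i. (1 / sqrt (1 - c i)) \<cdot>\<^sub>v e i)"
  have x: "x i \<in> carrier_vec m" for i using e by (simp add: x_def)
  have prod_x: "x i \<bullet> d = (1 / sqrt (1 - c i)) * (e i \<bullet> d)" if "d \<in> carrier_vec m" for i d
    unfolding x_def using e that by (rule smult_scalar_prod_distrib)
  have "bessel m r x"
  proof (rule bessel_if_orthogonal[OF x])
    fix i k assume i: "i \<in> {1..r}" and k: "k \<in> {1..r}"
    have xx: "x i \<bullet> x k = (1 / sqrt (1 - c i)) * ((1 / sqrt (1 - c k)) * (e i \<bullet> e k))"
      unfolding prod_x[OF x] by (simp add: x_def scalar_prod_smult_distrib[OF e e])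
    show "x i \<bullet> x k = 0" if "i \<noteq> k" using xx ee[OF i k] that by simp
  next
    fix i assume i: "i \<in> {1..r}"
    have "x i \<bullet> x i = (1 / sqrt (1 - c i)) * ((1 / sqrt (1 - c i)) * (e i \<bullet> e i))"
      unfolding prod_x[OF x] by (simp add: x_def scalar_prod_smult_distrib[OF e e])
    then show "x i \<bullet> x i \<le> 1" using ee[OF i i] c[OF i] by simp
  qed
  moreover
  define y where "y = (\<lambda>i. comb n r (\<lambda>j. s r / s j * w i $ (j - 1)) v)"
  have y: "y i \<in> carrier_vec n" for i by (simp add: y_def)
  have ratio: "0 \<le> s r / s j" "s r / s j \<le> 1" "0 < s j" if "j \<in> {1..r}" for j
    using s_ge[OF that] s_pos by auto
  have "bessel n r y"
    unfolding bessel_def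
  proof (intro conjI ballI)
    fix d :: "real vec" assume d: "d \<in> carrier_vec n"
    define h where "h = vec r (\<lambda>j. s r / s (Suc j) * (v (Suc j) \<bullet> d))"
    have h: "h \<in> carrier_vec r" by (simp add: h_def)
    have yd: "y i \<bullet> d = w i \<bullet> h" for i
    proof -
      have "y i \<bullet> d = (\<Sum>j = 1..r. s r / s j * w i $ (j - 1) * (v j \<bullet> d))"
        unfolding y_def by (rule scalar_prod_comb_left[OF vc d])
      also have "\<dots> = w i \<bullet> h" by (simp add: h_def scalar_prod_def[of "w i"] sum_from_1_eq algebra_simps)
      finally show ?thesis .
    qed
    have "(\<Sum>i = 1..r. (y i \<bullet> d)\<^sup>2) \<le> h \<bullet> h"
      unfolding yd by (rule besselD(2)[OF bessel_if_orthonormal[OF w] h])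
    also have "h \<bullet> h = (\<Sum>j = 1..r. (s r / s j)\<^sup>2 * (v j \<bullet> d)\<^sup>2)"
      unfolding scalar_prod_def[of h h] by (simp add: h_def sum_from_1_eq power2_eq_square algebra_simps)
    also have "\<dots> \<le> (\<Sum>j = 1..r. 1 * (v j \<bullet> d)\<^sup>2)"
      using ratio by (intro sum_mono mult_right_mono power_le_one) auto
    also have "\<dots> \<le> d \<bullet> d" using besselD(2)[OF bessel_if_orthonormal[OF v] d] by simp
    finally show "(\<Sum>i = 1..r. (y i \<bullet> d)\<^sup>2) \<le> d \<bullet> d" .
  qed (use y in auto)
  moreover have "s r * sqrt (1 - c i) = residual (x i) (y i)" if i: "i \<in> {1..r}" for i
  proof -
    have "x i \<bullet> f i = (1 / sqrt (1 - c i)) * (1 - c i)" using prod_x[OF f] ef[OF i i] by simp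
    also have "\<dots> = sqrt (1 - c i)" using c[OF i] by (simp add: real_div_sqrt)
    finally have "s r * sqrt (1 - c i) = s r * (x i \<bullet> f i)" by simp
    also have "x i \<bullet> f i = (\<Sum>j = 1..r. w i $ (j - 1) * (x i \<bullet> u j))"
      unfolding f_def by (rule scalar_prod_comb_right[OF uc])
    also have "s r * \<dots> = (\<Sum>j = 1..r. s j * (x i \<bullet> u j) * (v j \<bullet> y i))"
      unfolding sum_distrib_left
    proof (rule sum.cong[OF refl])
      fix j assume j: "j \<in> {1..r}"
      have "v j \<bullet> y i = s r / s j * w i $ (j - 1)"
        unfolding y_def using scalar_prod_comb_orthonormal[OF v j le_refl] j by simp
      then show "s r * (w i $ (j - 1) * (x i \<bullet> u j)) = s j * (x i \<bullet> u j) * (v j \<bullet> y i)"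
        using ratio(3)[OF j] by simp
    qed
    also have "\<dots> = (\<Sum>j = 1..N. t j * (x i \<bullet> uh j) * (vh j \<bullet> y i))
        - (\<Sum>j = 1..N. z j * (x i \<bullet> a j) * (b j \<bullet> y i))"
      using forms[OF x y] by simp
    also have "(\<Sum>j = 1..N. t j * (x i \<bullet> uh j) * (vh j \<bullet> y i))
        = (\<Sum>j = Suc r..N. t j * (x i \<bullet> uh j) * (vh j \<bullet> y i))"
    proof (rule sum.mono_neutral_right)
      show "\<forall>j\<in>{1..N} - {Suc r..N}. t j * (x i \<bullet> uh j) * (vh j \<bullet> y i) = 0"
      proof
        fix j assume "j \<in> {1..N} - {Suc r..N}"
        then have j: "j \<in> {1..r}" by auto
        have "x i \<bullet> uh j = 0"
          using prod_x[OF uhc[OF j]] uhe[OF j, of i] comm_scalar_prod[OF e uhc[OF j]] by simp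
        then show "t j * (x i \<bullet> uh j) * (vh j \<bullet> y i) = 0" by simp
      qed
    qed auto
    also have "\<dots> = (\<Sum>j = 1..N - r. t (r + j) * (x i \<bullet> uh (r + j)) * (vh (r + j) \<bullet> y i))"
      by (rule sum.reindex_bij_witness[of _ "\<lambda>j. r + j" "\<lambda>j. j - r"]) auto
    finally show ?thesis by (simp add: residual_def)
  qed
  ultimately show thesis using c that by blast
qed

lemma sin_Theta_dist_le:
  defines "U \<equiv> mat_of_cols m (map u [1..<Suc r])" and "Uh \<equiv> mat_of_cols m (map uh [1..<Suc r])"
  shows "sin_Theta_dist \<infinity> Uh U \<le> 2 * z 1 / s r"
    and "1 \<le> p \<Longrightarrow> sin_Theta_dist (ereal p) Uh U \<le> 2 * (\<Sum>i = 1..r. z i powr p) powr (1 / p) / s r"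
proof -
  have uhr: "orthonormal_upto m r uh" using uh r(2) by (rule orthonormal_mono)
  from sin_Theta_dist_spectrum[OF u uhr, folded U_def Uh_def] obtain w c where w: "orthonormal_upto r r w"
    and gram: "\<And>i k. i \<in> {1..r} \<Longrightarrow> k \<in> {1..r} \<Longrightarrow>
        (\<Sum>j = 1..r. (uh j \<bullet> comb m r (\<lambda>l. w i $ (l - 1)) u) * (uh j \<bullet> comb m r (\<lambda>l. w k $ (l - 1)) u))
          = (if i = k then c i else 0)"
    and fin: "\<And>p. 1 \<le> p \<Longrightarrow> sin_Theta_dist (ereal p) Uh U = (\<Sum>i = 1..r. sqrt (1 - c i) powr p) powr (1 / p)"
    and inf: "1 \<le> r \<Longrightarrow> \<exists>i\<in>{1..r}. sin_Theta_dist \<infinity> Uh U = sqrt (1 - c i)"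
    by blast
  from sines_eq_residual[OF w gram] obtain x y where x: "bessel m r x" and y: "bessel n r y"
    and res: "\<And>i. i \<in> {1..r} \<Longrightarrow> s r * sqrt (1 - c i) = residual (x i) (y i)"
    and c: "\<And>i. i \<in> {1..r} \<Longrightarrow> c i \<le> 1" by blast
  have abs_res: "\<bar>residual (x i) (y i)\<bar> = s r * sqrt (1 - c i)" if "i \<in> {1..r}" for i
    using res[OF that] c[OF that] s_pos by (metis abs_of_nonneg diff_ge_0_iff_ge less_imp_le mult_nonneg_nonneg real_sqrt_ge_zero)
  show "sin_Theta_dist \<infinity> Uh U \<le> 2 * z 1 / s r"
  proof -
    obtain i where i: "i \<in> {1..r}" "sin_Theta_dist \<infinity> Uh U = sqrt (1 - c i)" using inf r by blast
    \<comment> \<open>For the spectral norm a single pair of vectors with exponent 1 suffices.\<close>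
    have single: "bessel d 1 (\<lambda>_. g i)" if "bessel d r g" for d and g :: "nat \<Rightarrow> real vec"
      unfolding bessel_def
    proof (intro conjI ballI)
      fix e :: "real vec" assume e: "e \<in> carrier_vec d"
      have "(g i \<bullet> e)\<^sup>2 \<le> (\<Sum>j = 1..r. (g j \<bullet> e)\<^sup>2)" using i(1) by (intro member_le_sum) auto
      also have "\<dots> \<le> e \<bullet> e" by (rule besselD(2)[OF that e])
      finally show "(\<Sum>j = 1..1::nat. (g i \<bullet> e)\<^sup>2) \<le> e \<bullet> e" by simp
    qed (use besselD(1)[OF that i(1)] in auto)
    have "\<bar>residual (x i) (y i)\<bar> \<le> 2 * z 1"
      using residual_powr_le[OF single[OF x] single[OF y], of 1] r z_nonneg[of 1] by simp
    then show ?thesis using abs_res[OF i(1)] i(2) s_pos by (simp add: field_simps)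
  qed
  show "sin_Theta_dist (ereal p) Uh U \<le> 2 * (\<Sum>i = 1..r. z i powr p) powr (1 / p) / s r" if p: "1 \<le> p"
  proof -
    define S where "S = (\<Sum>i = 1..r. sqrt (1 - c i) powr p)"
    define R where "R = (\<Sum>i = 1..r. z i powr p)"
    have SR: "0 \<le> S" "0 \<le> R" by (auto simp: S_def R_def intro: sum_nonneg)
    have "s r powr p * S = (\<Sum>i = 1..r. \<bar>residual (x i) (y i)\<bar> powr p)"
      unfolding S_def sum_distrib_left using abs_res c s_pos by (intro sum.cong refl) (simp add: powr_mult)
    also have "\<dots> \<le> 2 powr p * R"
      unfolding R_def by (rule residual_powr_le[OF x y r p])
    finally have "(s r powr p * S) powr (1 / p) \<le> (2 powr p * R) powr (1 / p)"
      using p SR by (intro powr_mono2) auto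
    then have "s r * S powr (1 / p) \<le> 2 * R powr (1 / p)"
      using p SR s_pos by (simp add: powr_mult powr_powr)
    then show ?thesis using fin[OF p] s_pos by (simp add: S_def R_def field_simps)
  qed
qed

end

theorem theorem5:
  fixes m n r :: nat
    and A B Z Zr U V Uh Vh :: "real mat"
    and q :: ereal
  assumes "0 < m" and "0 < n" and "0 < r" and "r \<le> min m n"
    and "A \<in> carrier_mat m n" and "Z \<in> carrier_mat m n"
    and "B = A + Z"
    and "vec_space.rank m A = r"
    and "leading_singular_vectors r A U V"
    and "leading_singular_vectors r B Uh Vh"
    and "is_svd_truncation r Z Zr"
    and "1 \<le> q"
  shows "max (sin_Theta_dist q Uh U) (sin_Theta_dist q Vh V)
           \<le> 2 * schatten_norm q Zr / singular_value A r"
proof -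
  have r: "1 \<le> r" "r \<le> min m n" using assms by auto
  note A = assms(5) and Z = assms(6)
  have B: "B \<in> carrier_mat m n" using A Z assms(7) by simp
  obtain u v where svdA: "is_svd A u v"
    and U: "U = mat_of_cols m (map u [1..<Suc r])" and V: "V = mat_of_cols n (map v [1..<Suc r])"
    using assms(9) A by (auto simp: leading_singular_vectors_def)
  obtain uh vh where svdB: "is_svd B uh vh"
    and Uh: "Uh = mat_of_cols m (map uh [1..<Suc r])" and Vh: "Vh = mat_of_cols n (map vh [1..<Suc r])"
    using assms(10) B by (auto simp: leading_singular_vectors_def)
  obtain a b where svdZ: "is_svd Z a b" using assms(11) by (auto simp: is_svd_truncation_def)
  define N where "N = min m n"
  note outA = is_svd_eq_outer_sum[OF svdA A, folded N_def]
  note outB = is_svd_eq_outer_sum[OF svdB B, folded N_def]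
  note outZ = is_svd_eq_outer_sum[OF svdZ Z, folded N_def]
  have rN: "r \<le> N" using r by (simp add: N_def)
  note rankA = is_svd_rank[OF svdA A assms(8) r, folded N_def]
  have form: "x \<bullet> (M *\<^sub>v y) = (\<Sum>j = 1..N. singular_value M j * (x \<bullet> f j) * (g j \<bullet> y))"
    if "is_svd M f g" "M \<in> carrier_mat m n" "x \<in> carrier_vec m" "y \<in> carrier_vec n" for M f g x y
  proof -
    note out = is_svd_eq_outer_sum[OF that(1,2), folded N_def]
    show ?thesis
      by (subst out(1))
        (rule scalar_prod_outer_sum[OF that(4) orthonormal_carrier[OF out(3)] orthonormal_carrier[OF out(2)]])
  qed
  have forms: "(\<Sum>j = 1..N. singular_value B j * (x \<bullet> uh j) * (vh j \<bullet> y))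
      = (\<Sum>j = 1..r. singular_value A j * (x \<bullet> u j) * (v j \<bullet> y))
        + (\<Sum>j = 1..N. singular_value Z j * (x \<bullet> a j) * (b j \<bullet> y))"
    if x: "x \<in> carrier_vec m" and y: "y \<in> carrier_vec n" for x y
  proof -
    have "x \<bullet> (B *\<^sub>v y) = x \<bullet> (A *\<^sub>v y) + x \<bullet> (Z *\<^sub>v y)"
      using A Z x y assms(7) by (simp add: add_mult_distrib_mat_vec scalar_prod_add_distrib[of _ m])
    moreover have "(\<Sum>j = 1..N. singular_value A j * (x \<bullet> u j) * (v j \<bullet> y))
        = (\<Sum>j = 1..r. singular_value A j * (x \<bullet> u j) * (v j \<bullet> y))"
      using rN rankA(2) by (intro sum.mono_neutral_right) auto
    ultimately show ?thesis
      using form[OF svdA A x y] form[OF svdB B x y] form[OF svdZ Z x y] by simp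
  qed
  interpret left: low_rank_perturbation m n N r "singular_value A" "singular_value B" "singular_value Z" u v uh vh a b
  proof
    show "orthonormal_upto m r u" "orthonormal_upto n r v"
      using outA rN orthonormal_mono by blast+
    show "singular_value A r \<le> singular_value A j" if "j \<in> {1..r}" for j
      using that is_svd_singular_value_antimono[OF svdA A, of j r] rN by (simp add: N_def)
    show "0 \<le> singular_value B j" "0 \<le> singular_value Z j" if "j \<in> {1..N}" for j
      using that is_svd_singular_value_nonneg[OF svdB B] is_svd_singular_value_nonneg[OF svdZ Z] by (auto simp: N_def)
    show "singular_value B j \<le> singular_value B i" "singular_value Z j \<le> singular_value Z i"
      if "1 \<le> i" "i \<le> j" "j \<le> N" for i j
      using that is_svd_singular_value_antimono[OF svdB B] is_svd_singular_value_antimono[OF svdZ Z] by (auto simp: N_def)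
  qed (use r rN outB outZ rankA(1) forms in auto)
  interpret right: low_rank_perturbation n m N r "singular_value A" "singular_value B" "singular_value Z" v u vh uh b a
  proof
    fix y x :: "real vec" assume y: "y \<in> carrier_vec n" and x: "x \<in> carrier_vec m"
    have swap: "(\<Sum>j = 1..k. s j * (y \<bullet> g j) * (f j \<bullet> x)) = (\<Sum>j = 1..k. s j * (x \<bullet> f j) * (g j \<bullet> y))"
      if "orthonormal_upto m k f" "orthonormal_upto n k g" for k s f g
    proof (rule sum.cong[OF refl])
      fix j assume j: "j \<in> {1..k}"
      show "s j * (y \<bullet> g j) * (f j \<bullet> x) = s j * (x \<bullet> f j) * (g j \<bullet> y)"
        using comm_scalar_prod[OF y orthonormal_carrier[OF that(2) j]]
          comm_scalar_prod[OF x orthonormal_carrier[OF that(1) j]] by simp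
    qed
    show "(\<Sum>j = 1..N. singular_value B j * (y \<bullet> vh j) * (uh j \<bullet> x))
      = (\<Sum>j = 1..r. singular_value A j * (y \<bullet> v j) * (u j \<bullet> x))
        + (\<Sum>j = 1..N. singular_value Z j * (y \<bullet> b j) * (a j \<bullet> x))"
      unfolding swap[OF left.uh left.vh] swap[OF left.u left.v] swap[OF left.a left.b] by (rule forms[OF x y])
  qed (fact left.r left.u left.v left.uh left.vh left.a left.b left.s_pos left.s_ge left.t_nonneg left.t_dec
      left.z_nonneg left.z_dec)+
  note trunc = schatten_norm_truncation[OF assms(11) Z r]
  show ?thesis
  proof (cases "q = \<infinity>")
    case True
    then show ?thesis
      using left.sin_Theta_dist_le(1) right.sin_Theta_dist_le(1) trunc(1) U V Uh Vh by simp
  next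
    case False
    then obtain p where p: "q = ereal p" "1 \<le> p" using assms(12) by (cases q) auto
    show ?thesis
      using left.sin_Theta_dist_le(2)[OF p(2)] right.sin_Theta_dist_le(2)[OF p(2)] trunc(2)[OF p(2)] U V Uh Vh p(1)
      by simp
  qed
qed

end
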